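(* Let $M\ge 1$ be an integer and let $U\subset\mathbb{R}^{n+1}$ be a bounded slice Cauchy domain. For $\mathrm{j}\in\mathbb{S}$ set $ds_{\mathrm{j}}=ds\,(-\mathrm{j})$ and $\overline{\partial_{\mathrm{j}}}=\frac12(\partial_u+\mathrm{j}\partial_v)$. (I) If $F$ is left poly slice monogenic of order $M$ on an axially symmetric open set containing $\overline U$, then $$F(x)=\frac{1}{2\pi}\int_{\partial(U\cap\mathbb{C}_{\mathrm{j}})}\sum_{\ell=0}^{M-1}(-2)^\ell P_\ell S_L^{-1}(s,x)\,ds_{\mathrm{j}}\,\overline{\partial_{\mathrm{j}}}^{\,\ell}F(s)\qquad\text{for all }x\in U.$$ (II) If $F$ is right poly slice monogenic of order $M$ on an axially symmetric open set containing $\overline U$, then $$F(x)=\frac{1}{2\pi}\int_{\partial(U\cap\mathbb{C}_{\mathrm{j}})}\sum_{\ell=0}^{M-1}(-2)^\ell F(s)\overline{\partial_{\mathrm{j}}}^{\,\ell}\,ds_{\mathrm{j}}\,P_\ell S_R^{-1}(s,x)\qquad\text{for all }x\in U.$$ The integrals depend neither on $U$ nor on the imaginary unit $\mathrm{j}\in\mathbb{S}$.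
   Context: $\mathbb{R}_n$ is the real Clifford algebra generated by $e_1,\dots,e_n$ with $e_\ell e_m+e_me_\ell=0$ ($\ell\ne m$), $e_\ell^2=-1$. A point $(x_0,\dots,x_n)\in\mathbb{R}^{n+1}$ is identified with the paravector $x=x_0+\sum_{\ell=1}^n x_\ell e_\ell\in\mathbb{R}_n$; $\mathrm{Re}(x)=x_0$, $\overline{x}=x_0-\sum x_\ell e_\ell$, $|x|^2=\sum_{\ell=0}^n x_\ell^2$. $\mathbb{S}=\{\sum_{\ell=1}^n x_\ell e_\ell:\sum x_\ell^2=1\}$, so $\mathrm{j}^2=-1$ for $\mathrm{j}\in\mathbb{S}$; $\mathbb{C}_{\mathrm{j}}=\mathbb{R}+\mathrm{j}\mathbb{R}$. For $x=x_0+\underline{x}$, $[x]=\{x_0+\mathrm{j}|\underline{x}|:\mathrm{j}\in\mathbb{S}\}$. A set $U\subset\mathbb{R}^{n+1}$ is axially symmetric if $[x]\subset U$ for all $x\in U$. Let $U$ be axially symmetric and open and $\mathcal{U}=\{(u,v)\in\mathbb{R}^2:u+\mathbb{S}v\subset U\}$. A left (right) slice function is $F:U\to\mathbb{R}_n$ with $F(u+\mathrm{j}v)=F_0(u,v)+\mathrm{j}F_1(u,v)$ (resp. $F_0(u,v)+F_1(u,v)\mathrm{j}$) for all $\mathrm{j}\in\mathbb{S}$, where $F_0,F_1:\mathcal{U}\to\mathbb{R}_n$ satisfy $F_0(u,-v)=F_0(u,v)$, $F_1(u,-v)=-F_1(u,v)$. It is left (right) poly slice monogenic of order $M$ if $F_0,F_1$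 are of class $\mathcal{C}^M$ and, for all $\mathrm{j}\in\mathbb{S}$, $\frac{1}{2^M}(\partial_u+\mathrm{j}\partial_v)^M(F_0+\mathrm{j}F_1)=0$ (resp. $(F_0+F_1\mathrm{j})\frac{1}{2^M}(\partial_u+\mathrm{j}\partial_v)^M=0$, with $\mathrm{j}$ multiplying from the right). In the integrals $s=u+\mathrm{j}v\in\mathbb{C}_{\mathrm{j}}$; $\overline{\partial_{\mathrm{j}}}F=\frac12(\partial_uF+\mathrm{j}\,\partial_vF)$ and $F\overline{\partial_{\mathrm{j}}}=\frac12(\partial_uF+(\partial_vF)\mathrm{j})$, applied to the restriction of $F$ to $\mathbb{C}_{\mathrm{j}}$. Kernels, for $s\notin[x]$ and integers $\ell\ge0$: $$P_\ell S_L^{-1}(s,x)=\frac{(\mathrm{Re}(s-x))^\ell}{\ell!}S_L^{-1}(s,x),\qquad P_\ell S_R^{-1}(s,x)=\frac{(\mathrm{Re}(s-x))^\ell}{\ell!}S_R^{-1}(s,x),$$ with $S_L^{-1}(s,x)=-(x^2-2\mathrm{Re}(s)x+|s|^2)^{-1}(x-\overline{s})$, $S_R^{-1}(s,x)=-(x-\overline{s})(x^2-2\mathrm{Re}(s)x+|s|^2)^{-1}$. A slice Cauchy domain is an axially symmetric open set $U$ such that for every $\mathrm{j}\in\mathbb{S}$ the boundary $\partial(U\cap\mathbb{C}_{\mathrm{j}})$ is a finite union of non-intersecting piecewise continuously differentiable Jordan curves, positively oriented with respect to $U\cap\mathbb{C}_{\mathrm{j}}$. *)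

theory Defs
  imports "HOL-Complex_Analysis.Complex_Analysis"
begin

unbundle no fps_syntax

section \<open>The real Clifford algebra\<close>

text \<open>
  The algebra with generators \<open>e i\<close>, \<open>i :: 'n\<close>, is modelled on the coefficient space with basis
  \<open>e\<^sub>A\<close>, \<open>A :: 'n set\<close>, where \<open>e\<^sub>A\<close> is the product of the \<open>e i\<close>, \<open>i \<in> A\<close>, in increasing order, so
  \<open>n = CARD('n) \<ge> 1\<close>. The norm is the Euclidean norm of the coefficients (it is not
  submultiplicative).
\<close>

typedef 'n clifford = "UNIV :: (real, 'n set) vec set"
  morphisms coeffs Clifford
  by simp

setup_lifting type_definition_clifford

text \<open>
  \<open>e\<^sub>A e\<^sub>B = clifford_sign A B \<cdot> e\<^sub>C\<close> with \<open>C\<close> the symmetric difference of \<open>A\<close> and \<open>B\<close>: each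
  pair \<open>b < a\<close> costs one anticommutation, each pair \<open>a = b\<close> one relation \<open>e a * e a = -1\<close>.
\<close>

definition clifford_sign :: "'n::{finite,linorder} set \<Rightarrow> 'n set \<Rightarrow> real"
  where "clifford_sign A B = (\<Prod>a\<in>A. \<Prod>b\<in>B. if b \<le> a then -1 else 1)"

lemma prod_sym_diff_sign:
  fixes f :: "'a::finite \<Rightarrow> real"
  assumes "\<And>a. f a * f a = 1"
  shows "prod f (sym_diff A B) = prod f A * prod f B"
proof -
  have s: "prod f X * prod f X = 1" for X
    using assms by (simp flip: prod.distrib)
  have A: "prod f A = prod f (A - B) * prod f (A \<inter> B)"
    by (subst prod.union_disjoint[symmetric]) (auto intro!: arg_cong[where f="prod f"])
  have B: "prod f B = prod f (B - A) * prod f (A \<inter> B)"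
    by (subst prod.union_disjoint[symmetric]) (auto intro!: arg_cong[where f="prod f"])
  have "prod f (sym_diff A B) = prod f (A - B) * prod f (B - A)"
    by (rule prod.union_disjoint) auto
  also have "\<dots> = prod f (A - B) * prod f (B - A) * (prod f (A \<inter> B) * prod f (A \<inter> B))"
    by (simp only: s mult_1_right)
  also have "\<dots> = prod f A * prod f B"
    unfolding A B by (simp only: mult_ac)
  finally show ?thesis .
qed

lemma clifford_sign_sym_diff_left:
  "clifford_sign (sym_diff A B) C = clifford_sign A C * clifford_sign B C"
  unfolding clifford_sign_def
  by (rule prod_sym_diff_sign) (auto simp flip: prod.distrib intro!: prod.neutral)

lemma clifford_sign_sym_diff_right:
  "clifford_sign A (sym_diff B C) = clifford_sign A B * clifford_sign A C"
proof -
  have "(\<Prod>b\<in>sym_diff B C. if b \<le> a then -1 else 1 :: real)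
      = (\<Prod>b\<in>B. if b \<le> a then -1 else 1) * (\<Prod>b\<in>C. if b \<le> a then -1 else 1)" for a
    by (rule prod_sym_diff_sign) simp
  then show ?thesis
    unfolding clifford_sign_def by (simp add: prod.distrib)
qed

lemma clifford_sign_empty [simp]: "clifford_sign {} A = 1" "clifford_sign A {} = 1"
  by (simp_all add: clifford_sign_def)

lemma sum_sym_diff_reindex:
  fixes f :: "'n::finite set \<Rightarrow> real"
  shows "(\<Sum>B\<in>UNIV. f (sym_diff A B)) = (\<Sum>B\<in>UNIV. f B)"
proof (rule sum.reindex_bij_witness[where i = "sym_diff A" and j = "sym_diff A"])
qed auto

instantiation clifford :: (finite) real_vector
begin

lift_definition zero_clifford :: "'a clifford" is 0 .
lift_definition plus_clifford :: "'a clifford \<Rightarrow> 'a clifford \<Rightarrow> 'a clifford" is "(+)" .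
lift_definition minus_clifford :: "'a clifford \<Rightarrow> 'a clifford \<Rightarrow> 'a clifford" is "(-)" .
lift_definition uminus_clifford :: "'a clifford \<Rightarrow> 'a clifford" is uminus .
lift_definition scaleR_clifford :: "real \<Rightarrow> 'a clifford \<Rightarrow> 'a clifford" is "scaleR" .

instance
  by standard (transfer; simp add: algebra_simps)+

end

instantiation clifford :: (finite) euclidean_space
begin

lift_definition inner_clifford :: "'a clifford \<Rightarrow> 'a clifford \<Rightarrow> real" is "inner" .
lift_definition norm_clifford :: "'a clifford \<Rightarrow> real" is norm .

definition Basis_clifford :: "'a clifford set" where "Basis_clifford = Clifford ` Basis"
definition dist_clifford :: "'a clifford \<Rightarrow> 'a clifford \<Rightarrow> real"
  where "dist_clifford x y = norm (x - y)"
definition sgn_clifford :: "'a clifford \<Rightarrow> 'a clifford"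
  where "sgn_clifford x = x /\<^sub>R norm x"
definition uniformity_clifford :: "('a clifford \<times> 'a clifford) filter"
  where "uniformity_clifford = (INF e\<in>{0 <..}. principal {(x, y). dist x y < e})"
definition open_clifford :: "'a clifford set \<Rightarrow> bool"
  where "open_clifford U \<longleftrightarrow> (\<forall>x\<in>U. eventually (\<lambda>(x', y). x' = x \<longrightarrow> y \<in> U) uniformity)"

instance
proof
  fix x y z :: "'a clifford" and r :: real
  show "sgn x = x /\<^sub>R norm x" by (rule sgn_clifford_def)
  show "dist x y = norm (x - y)" by (rule dist_clifford_def)
  show "(uniformity :: ('a clifford \<times> 'a clifford) filter)
      = (INF e\<in>{0 <..}. principal {(x, y). dist x y < e})"
    by (rule uniformity_clifford_def)
  show "open U \<longleftrightarrow> (\<forall>x\<in>U. eventually (\<lambda>(x', y). x' = x \<longrightarrow> y \<in> U) uniformity)"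
    for U :: "'a clifford set"
    by (rule open_clifford_def)
  show "inner x y = inner y x" by transfer (rule inner_commute)
  show "inner (x + y) z = inner x z + inner y z" by transfer (rule inner_add_left)
  show "inner (r *\<^sub>R x) y = r * inner x y" by transfer simp
  show "0 \<le> inner x x" by transfer simp
  show "inner x x = 0 \<longleftrightarrow> x = 0" by transfer simp
  show "norm x = sqrt (inner x x)" by transfer (rule norm_eq_sqrt_inner)
  show "(Basis :: 'a clifford set) \<noteq> {}" by (simp add: Basis_clifford_def)
  show "finite (Basis :: 'a clifford set)" by (simp add: Basis_clifford_def)
  show "inner u v = (if u = v then 1 else 0)" if "u \<in> Basis" "v \<in> Basis" for u v :: "'a clifford"
    using that unfolding Basis_clifford_def
    by (auto simp: inner_clifford.abs_eq inner_Basis Clifford_inject)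
  show "(\<forall>u\<in>Basis. inner x u = 0) \<longleftrightarrow> x = 0"
    unfolding Basis_clifford_def
    by (simp add: inner_clifford.rep_eq Clifford_inverse euclidean_all_zero_iff
        zero_clifford.rep_eq flip: coeffs_inject)
qed

end

instantiation clifford :: ("{finite,linorder}") real_algebra_1
begin

lift_definition one_clifford :: "'a clifford" is "axis {} 1" .

lift_definition times_clifford :: "'a clifford \<Rightarrow> 'a clifford \<Rightarrow> 'a clifford"
  is "\<lambda>x y. \<chi> C. \<Sum>A\<in>UNIV. clifford_sign A (sym_diff A C) * x $ A * y $ sym_diff A C" .

instance
proof
  fix a b c :: "'a clifford" and r :: real
  show "a * b * c = a * (b * c)"
  proof (transfer, rule iffD2[OF vec_eq_iff], rule allI, goal_cases)
    case (1 x y z D)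
    let ?s = "clifford_sign :: 'a set \<Rightarrow> _" and ?d = "sym_diff :: 'a set \<Rightarrow> _"
    have d: "?d (?d A B) D = ?d B (?d A D)" "?d A (?d A B) = B" for A B by auto
    have "(\<Sum>C\<in>UNIV. ?s C (?d C D) * (\<Sum>A\<in>UNIV. ?s A (?d A C) * x $ A * y $ ?d A C) * z $ ?d C D)
        = (\<Sum>C\<in>UNIV. \<Sum>A\<in>UNIV. ?s C (?d C D) * (?s A (?d A C) * x $ A * y $ ?d A C) * z $ ?d C D)"
      by (simp only: sum_distrib_left sum_distrib_right)
    also have "\<dots> = (\<Sum>A\<in>UNIV. \<Sum>C\<in>UNIV.
        ?s C (?d C D) * (?s A (?d A C) * x $ A * y $ ?d A C) * z $ ?d C D)"
      by (rule sum.swap)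
    also have "\<dots> = (\<Sum>A\<in>UNIV. \<Sum>B\<in>UNIV. ?s (?d A B) (?d (?d A B) D)
        * (?s A (?d A (?d A B)) * x $ A * y $ ?d A (?d A B)) * z $ ?d (?d A B) D)"
      by (rule sum.cong[OF refl], rule sum_sym_diff_reindex[symmetric])
    also have "\<dots> = (\<Sum>A\<in>UNIV. \<Sum>B\<in>UNIV. ?s A (?d A D) * x $ A *
        (?s B (?d B (?d A D)) * y $ B * z $ ?d B (?d A D)))"
    proof (intro sum.cong refl)
      fix A B :: "'a set"
      have "?s (?d A B) (?d B (?d A D)) * ?s A B = ?s A (?d B (?d B (?d A D))) * ?s B (?d B (?d A D))"
        by (simp only: clifford_sign_sym_diff_left clifford_sign_sym_diff_right mult_ac)
      then have *: "?s (?d A B) (?d B (?d A D)) * ?s A B = ?s A (?d A D) * ?s B (?d B (?d A D))"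
        by (simp only: d)
      show "?s (?d A B) (?d (?d A B) D)
        * (?s A (?d A (?d A B)) * x $ A * y $ ?d A (?d A B)) * z $ ?d (?d A B) D
        = ?s A (?d A D) * x $ A * (?s B (?d B (?d A D)) * y $ B * z $ ?d B (?d A D))"
        unfolding d using arg_cong[OF *, of "\<lambda>t. t * (x $ A * y $ B * z $ ?d B (?d A D))"]
        by (simp only: mult_ac)
    qed
    finally show ?case
      by (simp only: vec_lambda_beta sum_distrib_left)
  qed
  show "(a + b) * c = a * c + b * c"
    by transfer (simp add: vec_eq_iff algebra_simps sum.distrib)
  show "a * (b + c) = a * b + a * c"
    by transfer (simp add: vec_eq_iff algebra_simps sum.distrib)
  show "r *\<^sub>R a * b = r *\<^sub>R (a * b)"
    by transfer (simp add: vec_eq_iff sum_distrib_left mult_ac)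
  show "a * r *\<^sub>R b = r *\<^sub>R (a * b)"
    by transfer (simp add: vec_eq_iff sum_distrib_left mult_ac)
  show "1 * a = a"
  proof (transfer, rule iffD2[OF vec_eq_iff], rule allI, goal_cases)
    case (1 x C)
    have "(\<Sum>A\<in>UNIV. clifford_sign A (sym_diff A C) * axis {} 1 $ A * x $ sym_diff A C)
        = (\<Sum>A\<in>(UNIV :: 'a set set). if A = {} then x $ C else 0)"
      by (intro sum.cong refl) (auto simp: axis_def)
    then show ?case by simp
  qed
  show "a * 1 = a"
  proof (transfer, rule iffD2[OF vec_eq_iff], rule allI, goal_cases)
    case (1 x C)
    have "(\<Sum>A\<in>UNIV. clifford_sign A (sym_diff A C) * x $ A * axis {} 1 $ sym_diff A C)
        = (\<Sum>A\<in>UNIV. if A = C then x $ C else 0)"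
      by (intro sum.cong refl) (auto simp: axis_def)
    then show ?case by simp
  qed
  show "(0 :: 'a clifford) \<noteq> 1"
    by transfer (auto simp: vec_eq_iff axis_def)
qed

end

lift_definition clifford_gen :: "'n::{finite,linorder} \<Rightarrow> 'n clifford" is "\<lambda>i. axis {i} 1" .

lemma clifford_gen_mult_coeff:
  "coeffs (clifford_gen i * clifford_gen j) $ C
    = (if C = sym_diff {i} {j} then clifford_sign {i} {j} else 0)"
proof -
  have "coeffs (clifford_gen i * clifford_gen j) $ C
      = (\<Sum>A\<in>UNIV. clifford_sign A (sym_diff A C) * axis {i} 1 $ A * axis {j} 1 $ sym_diff A C)"
    by transfer simp
  also have "\<dots> = (\<Sum>A\<in>UNIV. if A = {i} then
      (if C = sym_diff {i} {j} then clifford_sign {i} {j} else 0) else 0)"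
  proof (intro sum.cong refl)
    fix A
    have "sym_diff {i} C = {j} \<longleftrightarrow> C = sym_diff {i} {j}" by auto
    then show "clifford_sign A (sym_diff A C) * axis {i} 1 $ A * axis {j} 1 $ sym_diff A C
      = (if A = {i} then (if C = sym_diff {i} {j} then clifford_sign {i} {j} else 0) else 0)"
      by (simp only: axis_def vec_lambda_beta) auto
  qed
  finally show ?thesis by simp
qed

lemma clifford_gen_square: "clifford_gen i * clifford_gen i = -1"
proof -
  have "coeffs (clifford_gen i * clifford_gen i) = - axis {} 1"
    by (auto simp: vec_eq_iff clifford_gen_mult_coeff axis_def clifford_sign_def)
  then show ?thesis
    by (simp flip: coeffs_inject add: uminus_clifford.rep_eq one_clifford.rep_eq)
qed

lemma clifford_gen_anticommute:
  assumes "i \<noteq> j"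
  shows "clifford_gen i * clifford_gen j + clifford_gen j * clifford_gen i = 0"
proof -
  have "coeffs (clifford_gen i * clifford_gen j) + coeffs (clifford_gen j * clifford_gen i) = 0"
    using assms by (auto simp: vec_eq_iff clifford_gen_mult_coeff clifford_sign_def)
  then show ?thesis
    by (simp flip: coeffs_inject add: plus_clifford.rep_eq zero_clifford.rep_eq)
qed

lemma DIM_clifford: "DIM('n::finite clifford) = 2 ^ CARD('n)"
proof -
  have "DIM('n clifford) = DIM((real, 'n set) vec)"
    unfolding Basis_clifford_def by (rule card_image) (simp add: inj_on_def Clifford_inject)
  then show ?thesis by (simp add: card_Pow flip: Pow_UNIV)
qed

text \<open>The inverse in the algebra; a junk value unless \<open>a\<close> is invertible.\<close>

definition clifford_inverse :: "'n::{finite,linorder} clifford \<Rightarrow> 'n clifford"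
  where "clifford_inverse a = (THE b. a * b = 1 \<and> b * a = 1)"


section \<open>Paravectors, slices and axially symmetric sets\<close>

text \<open>A point of \<open>\<real>\<^sup>n\<^sup>+\<^sup>1\<close> is a pair of its real part and its vector part.\<close>

type_synonym 'n vec_part = "real ^ 'n"

type_synonym 'n point = "real \<times> 'n vec_part"

definition paravec :: "'n::{finite,linorder} point \<Rightarrow> 'n clifford"
  where "paravec x = of_real (fst x) + (\<Sum>i\<in>UNIV. (snd x $ i) *\<^sub>R clifford_gen i)"

definition pcnj :: "'n::finite point \<Rightarrow> 'n point"
  where "pcnj x = (fst x, - snd x)"

abbreviation imag_units :: "'n::finite vec_part set"
  where "imag_units \<equiv> sphere 0 1"

definition imag_unit :: "'n vec_part \<Rightarrow> 'n::{finite,linorder} clifford"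
  where "imag_unit j = paravec (0, j)"

text \<open>
  Both the \<open>(u,v)\<close>-plane and each slice \<open>\<complex>\<^sub>j\<close> are modelled by the type \<open>complex\<close>; the latter via
  \<open>Complex u v \<mapsto> u + j v\<close>.
\<close>

definition slice_point :: "'n vec_part \<Rightarrow> complex \<Rightarrow> 'n::finite point"
  where "slice_point j z = (Re z, Im z *\<^sub>R j)"

definition slice :: "'n vec_part \<Rightarrow> 'n::finite point set \<Rightarrow> complex set"
  where "slice j U = {z. slice_point j z \<in> U}"

definition sphere_of :: "'n::finite point \<Rightarrow> 'n point set"
  where "sphere_of x = {(fst x, norm (snd x) *\<^sub>R j) | j. j \<in> imag_units}"

definition axially_symmetric :: "'n::finite point set \<Rightarrow> bool"
  where "axially_symmetric U \<longleftrightarrow> (\<forall>x\<in>U. sphere_of x \<subseteq> U)"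

definition plane_domain :: "'n::finite point set \<Rightarrow> complex set"
  where "plane_domain U = {z. \<forall>j\<in>imag_units. slice_point j z \<in> U}"


section \<open>Poly slice monogenic functions\<close>

definition pd_u :: "(complex \<Rightarrow> 'b::real_normed_vector) \<Rightarrow> complex \<Rightarrow> 'b"
  where "pd_u f z = vector_derivative (\<lambda>t. f (Complex t (Im z))) (at (Re z))"

definition pd_v :: "(complex \<Rightarrow> 'b::real_normed_vector) \<Rightarrow> complex \<Rightarrow> 'b"
  where "pd_v f z = vector_derivative (\<lambda>t. f (Complex (Re z) t)) (at (Im z))"

text \<open>Class \<open>C\<^sup>k\<close>, for open \<open>D\<close>: all partial derivatives up to order \<open>k\<close> exist and are continuous.\<close>

fun class_C :: "nat \<Rightarrow> complex set \<Rightarrow> (complex \<Rightarrow> 'b::real_normed_vector) \<Rightarrow> bool"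
  where
    "class_C 0 D f \<longleftrightarrow> continuous_on D f"
  | "class_C (Suc k) D f \<longleftrightarrow>
       (\<forall>z\<in>D. (\<lambda>t. f (Complex t (Im z))) differentiable at (Re z) \<and>
              (\<lambda>t. f (Complex (Re z) t)) differentiable at (Im z)) \<and>
       continuous_on D f \<and> class_C k D (pd_u f) \<and> class_C k D (pd_v f)"

definition cr_left :: "'n vec_part \<Rightarrow> (complex \<Rightarrow> 'n::{finite,linorder} clifford) \<Rightarrow> complex \<Rightarrow> 'n clifford"
  where "cr_left j f z = pd_u f z + imag_unit j * pd_v f z"

definition cr_right :: "'n vec_part \<Rightarrow> (complex \<Rightarrow> 'n::{finite,linorder} clifford) \<Rightarrow> complex \<Rightarrow> 'n clifford"
  where "cr_right j f z = pd_u f z + pd_v f z * imag_unit j"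

definition dbar_left :: "'n vec_part \<Rightarrow> (complex \<Rightarrow> 'n::{finite,linorder} clifford) \<Rightarrow> complex \<Rightarrow> 'n clifford"
  where "dbar_left j f z = (1/2) *\<^sub>R cr_left j f z"

definition dbar_right :: "'n vec_part \<Rightarrow> (complex \<Rightarrow> 'n::{finite,linorder} clifford) \<Rightarrow> complex \<Rightarrow> 'n clifford"
  where "dbar_right j f z = (1/2) *\<^sub>R cr_right j f z"

definition even_odd_pair ::
  "complex set \<Rightarrow> (complex \<Rightarrow> 'n::{finite,linorder} clifford) \<Rightarrow> (complex \<Rightarrow> 'n clifford) \<Rightarrow> bool"
  where "even_odd_pair D F0 F1 \<longleftrightarrow> (\<forall>z\<in>D. F0 (cnj z) = F0 z \<and> F1 (cnj z) = - F1 z)"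

definition left_poly_slice_monogenic ::
  "nat \<Rightarrow> 'n::{finite,linorder} point set \<Rightarrow> ('n point \<Rightarrow> 'n clifford) \<Rightarrow> bool"
  where "left_poly_slice_monogenic M U F \<longleftrightarrow>
    (\<exists>F0 F1. even_odd_pair (plane_domain U) F0 F1 \<and>
       (\<forall>z\<in>plane_domain U. \<forall>j\<in>imag_units. F (slice_point j z) = F0 z + imag_unit j * F1 z) \<and>
       class_C M (plane_domain U) F0 \<and> class_C M (plane_domain U) F1 \<and>
       (\<forall>j\<in>imag_units. \<forall>z\<in>plane_domain U.
          (1 / 2 ^ M) *\<^sub>R (cr_left j ^^ M) (\<lambda>w. F0 w + imag_unit j * F1 w) z = 0))"

definition right_poly_slice_monogenic ::
  "nat \<Rightarrow> 'n::{finite,linorder} point set \<Rightarrow> ('n point \<Rightarrow> 'n clifford) \<Rightarrow> bool"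
  where "right_poly_slice_monogenic M U F \<longleftrightarrow>
    (\<exists>F0 F1. even_odd_pair (plane_domain U) F0 F1 \<and>
       (\<forall>z\<in>plane_domain U. \<forall>j\<in>imag_units. F (slice_point j z) = F0 z + F1 z * imag_unit j) \<and>
       class_C M (plane_domain U) F0 \<and> class_C M (plane_domain U) F1 \<and>
       (\<forall>j\<in>imag_units. \<forall>z\<in>plane_domain U.
          (1 / 2 ^ M) *\<^sub>R (cr_right j ^^ M) (\<lambda>w. F0 w + F1 w * imag_unit j) z = 0))"

definition left_poly_slice_monogenic_near ::
  "nat \<Rightarrow> 'n::{finite,linorder} point set \<Rightarrow> ('n point \<Rightarrow> 'n clifford) \<Rightarrow> bool"
  where "left_poly_slice_monogenic_near M K F \<longleftrightarrow>
    (\<exists>W. open W \<and> axially_symmetric W \<and> K \<subseteq> W \<and> left_poly_slice_monogenic M W F)"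

definition right_poly_slice_monogenic_near ::
  "nat \<Rightarrow> 'n::{finite,linorder} point set \<Rightarrow> ('n point \<Rightarrow> 'n clifford) \<Rightarrow> bool"
  where "right_poly_slice_monogenic_near M K F \<longleftrightarrow>
    (\<exists>W. open W \<and> axially_symmetric W \<and> K \<subseteq> W \<and> right_poly_slice_monogenic M W F)"


section \<open>Cauchy kernels\<close>

definition kernel_quad :: "'n::{finite,linorder} point \<Rightarrow> 'n point \<Rightarrow> 'n clifford"
  where "kernel_quad s x = (paravec x)\<^sup>2 - (2 * fst s) *\<^sub>R paravec x + of_real ((norm s)\<^sup>2)"

definition S_L_inv :: "'n::{finite,linorder} point \<Rightarrow> 'n point \<Rightarrow> 'n clifford"
  where "S_L_inv s x = - clifford_inverse (kernel_quad s x) * (paravec x - paravec (pcnj s))"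

definition S_R_inv :: "'n::{finite,linorder} point \<Rightarrow> 'n point \<Rightarrow> 'n clifford"
  where "S_R_inv s x = - (paravec x - paravec (pcnj s)) * clifford_inverse (kernel_quad s x)"

definition P_S_L_inv :: "nat \<Rightarrow> 'n::{finite,linorder} point \<Rightarrow> 'n point \<Rightarrow> 'n clifford"
  where "P_S_L_inv l s x = (fst (s - x) ^ l / fact l) *\<^sub>R S_L_inv s x"

definition P_S_R_inv :: "nat \<Rightarrow> 'n::{finite,linorder} point \<Rightarrow> 'n point \<Rightarrow> 'n clifford"
  where "P_S_R_inv l s x = (fst (s - x) ^ l / fact l) *\<^sub>R S_R_inv s x"


section \<open>Slice Cauchy domains and boundary integrals\<close>

text \<open>
  A finite set of disjoint closed piecewise \<open>C\<^sup>1\<close> Jordan paths tracing the boundary of the bounded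
  plane open set \<open>D\<close>, positively oriented with respect to \<open>D\<close> in the usual sense for systems
  of curves: the total winding number is 1 about the points of \<open>D\<close> and 0 about the exterior points.
\<close>

definition positive_boundary :: "(real \<Rightarrow> complex) set \<Rightarrow> complex set \<Rightarrow> bool"
  where "positive_boundary \<Gamma> D \<longleftrightarrow>
    finite \<Gamma> \<and>
    (\<forall>\<gamma>\<in>\<Gamma>. valid_path \<gamma> \<and> simple_path \<gamma> \<and> pathfinish \<gamma> = pathstart \<gamma>) \<and>
    disjoint_family_on path_image \<Gamma> \<and>
    (\<Union>\<gamma>\<in>\<Gamma>. path_image \<gamma>) = frontier D \<and>
    (\<forall>z\<in>D. (\<Sum>\<gamma>\<in>\<Gamma>. winding_number \<gamma> z) = 1) \<and>
    (\<forall>z. z \<notin> closure D \<longrightarrow> (\<Sum>\<gamma>\<in>\<Gamma>. winding_number \<gamma> z) = 0)"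

definition slice_Cauchy_domain :: "'n::finite point set \<Rightarrow> bool"
  where "slice_Cauchy_domain U \<longleftrightarrow>
    axially_symmetric U \<and> open U \<and> (\<forall>j\<in>imag_units. \<exists>\<Gamma>. positive_boundary \<Gamma> (slice j U))"

text \<open>
  The density of \<open>ds\<^sub>j = ds (-j)\<close> along \<open>s = \<gamma> t\<close>, \<open>0 \<le> t \<le> 1\<close>. At the finitely many corners of a
  piecewise \<open>C\<^sup>1\<close> path its value is irrelevant.
\<close>

definition ds :: "'n vec_part \<Rightarrow> (real \<Rightarrow> complex) \<Rightarrow> real \<Rightarrow> 'n::{finite,linorder} clifford"
  where "ds j \<gamma> t =
    paravec (slice_point j (vector_derivative \<gamma> (at t within {0..1}))) * (- imag_unit j)"

definition left_integrand ::
  "nat \<Rightarrow> ('n point \<Rightarrow> 'n clifford) \<Rightarrow> 'n point \<Rightarrow> 'n vec_part \<Rightarrow> (real \<Rightarrow> complex) \<Rightarrow>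
   real \<Rightarrow> 'n::{finite,linorder} clifford"
  where "left_integrand M F x j \<gamma> t =
    (\<Sum>l<M. (-2) ^ l *\<^sub>R (P_S_L_inv l (slice_point j (\<gamma> t)) x * ds j \<gamma> t *
       (dbar_left j ^^ l) (\<lambda>z. F (slice_point j z)) (\<gamma> t)))"

definition right_integrand ::
  "nat \<Rightarrow> ('n point \<Rightarrow> 'n clifford) \<Rightarrow> 'n point \<Rightarrow> 'n vec_part \<Rightarrow> (real \<Rightarrow> complex) \<Rightarrow>
   real \<Rightarrow> 'n::{finite,linorder} clifford"
  where "right_integrand M F x j \<gamma> t =
    (\<Sum>l<M. (-2) ^ l *\<^sub>R ((dbar_right j ^^ l) (\<lambda>z. F (slice_point j z)) (\<gamma> t) * ds j \<gamma> t *
       P_S_R_inv l (slice_point j (\<gamma> t)) x))"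

definition left_integral ::
  "nat \<Rightarrow> ('n point \<Rightarrow> 'n clifford) \<Rightarrow> 'n point \<Rightarrow> 'n vec_part \<Rightarrow> (real \<Rightarrow> complex) set \<Rightarrow>
   'n::{finite,linorder} clifford"
  where "left_integral M F x j \<Gamma> = (\<Sum>\<gamma>\<in>\<Gamma>. integral {0..1} (left_integrand M F x j \<gamma>))"

definition right_integral ::
  "nat \<Rightarrow> ('n point \<Rightarrow> 'n clifford) \<Rightarrow> 'n point \<Rightarrow> 'n vec_part \<Rightarrow> (real \<Rightarrow> complex) set \<Rightarrow>
   'n::{finite,linorder} clifford"
  where "right_integral M F x j \<Gamma> = (\<Sum>\<gamma>\<in>\<Gamma>. integral {0..1} (right_integrand M F x j \<gamma>))"

end

theory Submission
  imports Defs
begin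

text \<open>
  Fix an imaginary unit \<open>j\<close> and a point \<open>x = u + k v\<close>, and write \<open>z = u + i v\<close>. The powers of
  \<open>Re (s - x)\<close> in the kernels are real and commute with everything, so the integrand of the left formula
  equals \<open>S_L_inv s x \<cdot> ds\<^sub>j \<cdot> h s\<close> with the single function
  \<open>h s = (\<Sum>l<M. (- 2 Re (s - x)) ^ l / l! \<cdot> dbar\<^sup>l F s)\<close>
  on the slice of \<open>j\<close>. Since \<open>dbar (Re s) = 1/2\<close>, applying \<open>dbar\<close> to this sum makes it telescope to a
  multiple of \<open>dbar\<^sup>M F = 0\<close> (\<open>holomorphic_part_CR\<close>): \<open>h\<close> satisfies the Cauchy-Riemann equation for \<open>j\<close>. And
  \<open>h\<close> agrees with \<open>F\<close> at \<open>u + j v\<close> and \<open>u - j v\<close>, because \<open>Re (s - x)\<close> vanishes there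
  (\<open>holomorphic_part_at\<close>). So a formula of order \<open>M\<close> for \<open>F\<close> is a Cauchy formula of order 1 for \<open>h\<close>.

  The kernel is an even part plus \<open>k\<close> times an odd part, both with values in the slice of \<open>j\<close>, and these are
  half the sum, respectively \<open>1/(2j)\<close> times the difference, of the classical kernels \<open>1/(s - z)\<close> and
  \<open>1/(s - cnj z)\<close> (\<open>S_inv_slice_point\<close>). Hence Cauchy's formula in the plane at the two points \<open>z\<close> and
  \<open>cnj z\<close> gives \<open>1/2 (F z + F (cnj z)) - 1/2 k j (F z - F (cnj z))\<close>, where \<open>F\<close> is restricted to the slice
  of \<open>j\<close>. For a slice function \<open>F = F0 + j F1\<close> this is \<open>F0 z + k F1 z = F x\<close>
  (\<open>poly_slice_cauchy_formula_stem\<close>).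

  Left and right formulas are treated at once: all that matters in the plane is a linear map \<open>J\<close> with
  \<open>J \<circ> J = - id\<close>, which is multiplication by \<open>j\<close> from the left or from the right. It turns the algebra into a
  complex vector space whose complex linear functionals reduce Cauchy's formula to complex-valued functions
  (\<open>cauchy_formula_cycle\<close>).

  The boundary of a slice may consist of several curves, and the domain of \<open>F\<close> on the slice may be
  disconnected, so Cauchy's formula is needed for a system of curves (\<open>Cauchy_integral_formula_cycle\<close>). It
  is proved with Dixon's argument: the integral of the divided difference of a holomorphic function over the
  system extends to an entire function that vanishes at infinity, hence is zero by Liouville's theorem.

  Independence of the domain and of the imaginary unit is then immediate: every one of the integrals equals
  \<open>2 \<pi> F x\<close>.
\<close>

section \<open>Cauchy's integral formula for systems of curves\<close>

definition divdiff :: "(complex \<Rightarrow> complex) \<Rightarrow> complex \<Rightarrow> complex \<Rightarrow> complex"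
  where "divdiff f z w = (if w = z then deriv f z else (f w - f z) / (w - z))"

lemma holomorphic_on_divdiff:
  assumes "f holomorphic_on S" "open S"
  shows "divdiff f z holomorphic_on S"
  using pole_lemma_open[OF assms, of z] by (simp add: divdiff_def[abs_def])

text \<open>
  The divided difference in the first argument is again a divided difference, of the function
  \<open>divdiff f u\<close>. This makes differentiability of integrals of \<open>divdiff f\<close> in \<open>z\<close> a matter of continuity
  only.
\<close>

lemma divdiff_diff:
  assumes f: "f holomorphic_on S" and S: "open S" and z: "z \<in> S"
  shows "divdiff f z w - divdiff f u w = (z - u) * divdiff (divdiff f u) z w"
proof -
  consider "z = u" | "z \<noteq> u" "w = z" | "z \<noteq> u" "w \<noteq> z" by blast
  then show ?thesis
  proof cases
    case 2
    have "(f has_field_derivative deriv f z) (at z)"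
      using f S z holomorphic_derivI by blast
    then have "((\<lambda>w. (f w - f u) / (w - u)) has_field_derivative
        (deriv f z - (f z - f u) / (z - u)) / (z - u)) (at z)"
      using 2 by (auto intro!: derivative_eq_intros simp: divide_simps)
    then have "(divdiff f u has_field_derivative (deriv f z - (f z - f u) / (z - u)) / (z - u)) (at z)"
      by (rule has_field_derivative_transform_within_open[of _ _ _ "- {u}"])
        (use 2 in \<open>auto simp: divdiff_def\<close>)
    then have "deriv (divdiff f u) z = (deriv f z - (f z - f u) / (z - u)) / (z - u)"
      by (rule DERIV_imp_deriv)
    then show ?thesis
      using 2 by (simp add: divdiff_def)
  next
    case 3
    show ?thesis
    proof (cases "w = u")
      case True
      then show ?thesis using 3 by (simp add: divdiff_def divide_simps) (simp add: algebra_simps)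
    next
      case False
      then show ?thesis using 3 by (simp add: divdiff_def divide_simps) (simp add: algebra_simps)
    qed
  qed simp
qed

lemma continuous_on_divdiff:
  assumes f: "f holomorphic_on S" and S: "open S"
  shows "continuous_on (S \<times> S) (\<lambda>(z, w). divdiff f z w)"
proof -
  have "isCont (\<lambda>(z, w). divdiff f z w) (a, b)" if ab: "a \<in> S" "b \<in> S" for a b
  proof (cases "a = b")
    case False
    have "isCont f a" "isCont f b"
      using f S ab holomorphic_on_imp_continuous_on continuous_on_eq_continuous_at by blast+
    then have "isCont (\<lambda>p. f (fst p)) (a, b)" "isCont (\<lambda>p. f (snd p)) (a, b)"
      using isCont_o2[where f = fst and g = f and a = "(a, b)"]
        isCont_o2[where f = snd and g = f and a = "(a, b)"] by simp_all
    then have "isCont (\<lambda>p. (f (snd p) - f (fst p)) / (snd p - fst p)) (a, b)"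
      using False by (auto intro!: continuous_intros)
    moreover have "open {p :: complex \<times> complex. fst p \<noteq> snd p}"
      by (intro open_Collect_neq continuous_intros)
    then have "\<forall>\<^sub>F p in nhds (a, b). fst p \<noteq> snd p"
      using False by (auto dest!: eventually_nhds_in_open[where x = "(a, b)"])
    then have "\<forall>\<^sub>F p in nhds (a, b).
        (case p of (z, w) \<Rightarrow> divdiff f z w) = (f (snd p) - f (fst p)) / (snd p - fst p)"
      by eventually_elim (auto simp: divdiff_def)
    ultimately show ?thesis
      using isCont_cong[of "\<lambda>(z, w). divdiff f z w"
          "\<lambda>p. (f (snd p) - f (fst p)) / (snd p - fst p)" "(a, b)"] by simp
  next
    case True
    obtain r where r: "r > 0" "ball a r \<subseteq> S"
      using ab S openE by blast
    have "isCont (deriv f) a"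
      using holomorphic_deriv[OF f S] S ab holomorphic_on_imp_continuous_on
        continuous_on_eq_continuous_at by blast
    show ?thesis
      unfolding True[symmetric] continuous_at_eps_delta
    proof (intro allI impI)
      fix e :: real assume "e > 0"
      then obtain d where d: "d > 0" "\<And>x. dist x a < d \<Longrightarrow> dist (deriv f x) (deriv f a) < e / 2"
        using \<open>isCont (deriv f) a\<close> unfolding continuous_at_eps_delta by (metis half_gt_zero)
      define B where "B = ball a (min d r)"
      have der: "((\<lambda>x. f x - deriv f a * x) has_field_derivative deriv f x - deriv f a) (at x within B)"
        if "x \<in> B" for x
        using that r f S by (auto intro!: derivative_eq_intros holomorphic_derivI simp: B_def)
      have bd: "cmod (deriv f x - deriv f a) \<le> e / 2" if "x \<in> B" for x
        using d(2)[of x] that by (auto simp: B_def dist_norm norm_minus_commute)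
      have *: "dist (divdiff f z w) (deriv f a) < e" if zw: "z \<in> B" "w \<in> B" for z w
      proof (cases "w = z")
        case True
        then show ?thesis using bd[OF zw(1)] \<open>e > 0\<close> by (auto simp: divdiff_def dist_norm)
      next
        case False
        have "cmod ((f w - deriv f a * w) - (f z - deriv f a * z)) \<le> e / 2 * cmod (w - z)"
          by (rule field_differentiable_bound[OF _ der bd]) (use zw in \<open>auto simp: B_def\<close>)
        moreover have "divdiff f z w - deriv f a
            = ((f w - deriv f a * w) - (f z - deriv f a * z)) / (w - z)"
          using False by (simp add: divdiff_def divide_simps) (simp add: algebra_simps)
        then have "dist (divdiff f z w) (deriv f a)
            = cmod ((f w - deriv f a * w) - (f z - deriv f a * z)) / cmod (w - z)"
          by (simp only: dist_norm norm_divide)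
        ultimately have "dist (divdiff f z w) (deriv f a) \<le> e / 2"
          using False by (simp add: pos_divide_le_eq)
        then show ?thesis using \<open>e > 0\<close> by simp
      qed
      show "\<exists>d>0. \<forall>x'. dist x' (a, a) < d \<longrightarrow>
          dist (case x' of (z, w) \<Rightarrow> divdiff f z w) (case (a, a) of (z, w) \<Rightarrow> divdiff f z w) < e"
      proof (intro exI[of _ "min d r"] conjI allI impI)
        fix p :: "complex \<times> complex" assume p: "dist p (a, a) < min d r"
        have "fst p \<in> B" "snd p \<in> B"
          using p dist_fst_le[of p "(a, a)"] dist_snd_le[of p "(a, a)"]
          by (auto simp: B_def dist_commute)
        then show "dist (case p of (z, w) \<Rightarrow> divdiff f z w)
            (case (a, a) of (z, w) \<Rightarrow> divdiff f z w) < e"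
          using * by (auto simp: split_beta divdiff_def[of f a a])
      qed (use d r in auto)
    qed
  qed
  then show ?thesis
    by (auto intro!: continuous_at_imp_continuous_on)
qed

lemma compact_neighbourhood_in_open:
  fixes K :: "'a::euclidean_space set"
  assumes "compact K" "open S" "K \<subseteq> S"
  obtains T where "compact T" "K \<subseteq> interior T" "T \<subseteq> S"
proof -
  obtain e where e: "e > 0" "(\<Union>x\<in>K. cball x e) \<subseteq> S"
    using compact_subset_open_imp_cball_epsilon_subset[OF assms] by blast
  define T where "T = {x + y | x y. x \<in> K \<and> y \<in> cball 0 e}"
  have "compact T"
    unfolding T_def by (intro compact_sums assms compact_cball)
  moreover have T: "T = (\<Union>x\<in>K. cball x e)"
  proof (intro equalityI subsetI)
    fix y assume "y \<in> (\<Union>x\<in>K. cball x e)"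
    then obtain x where "x \<in> K" "dist x y \<le> e" by auto
    then show "y \<in> T"
      unfolding T_def by (intro CollectI exI[of _ x] exI[of _ "y - x"]) (auto simp: dist_norm norm_minus_commute)
  next
    fix y assume "y \<in> T"
    then obtain x k where "x \<in> K" "norm k \<le> e" "y = x + k" by (auto simp: T_def)
    then show "y \<in> (\<Union>x\<in>K. cball x e)" by (auto intro!: bexI[of _ x] simp: dist_norm)
  qed
  moreover have "K \<subseteq> interior T"
  proof
    fix x assume "x \<in> K"
    then have "ball x e \<subseteq> T" unfolding T using ball_subset_cball by blast
    then show "x \<in> interior T"
      using e(1) by (meson centre_in_ball interiorI open_ball)
  qed
  ultimately show ?thesis using that e by blast
qed

text \<open>
  The derivative of a piecewise \<open>C\<^sup>1\<close> path may be unbounded near its corners, so a small integrand cannot be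
  estimated by the length of the path. For an integrand that is holomorphic near the path, its supremum on a
  compact neighbourhood of the path still controls the integral.
\<close>

lemma continuous_on_contour_integral_param:
  fixes F :: "complex \<Rightarrow> complex \<Rightarrow> complex"
  assumes S: "open S" and \<gamma>: "valid_path \<gamma>" "path_image \<gamma> \<subseteq> S"
    and hol: "\<And>z. z \<in> Z \<Longrightarrow> F z holomorphic_on S"
    and cont: "continuous_on (Z \<times> S) (\<lambda>(z, w). F z w)"
  shows "continuous_on Z (\<lambda>z. contour_integral \<gamma> (F z))"
  unfolding continuous_on_topological
proof (intro ballI allI impI)
  fix z0 B assume z0: "z0 \<in> Z" and B: "open B" "contour_integral \<gamma> (F z0) \<in> B"
  obtain T where T: "compact T" "path_image \<gamma> \<subseteq> interior T" "T \<subseteq> S"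
    using compact_neighbourhood_in_open[OF compact_valid_path_image S] \<gamma> by metis
  obtain L where L: "L > 0" "\<And>f B. f holomorphic_on interior T \<Longrightarrow> \<forall>z\<in>interior T. cmod (f z) \<le> B
      \<Longrightarrow> cmod (contour_integral \<gamma> f) \<le> L * B"
    using contour_integral_bound_exists[OF open_interior \<gamma>(1) T(2)] by blast
  obtain e where e: "e > 0" "ball (contour_integral \<gamma> (F z0)) e \<subseteq> B"
    using B openE by blast
  have "continuous_on (Z \<times> T) (\<lambda>(z, w). F z w)"
    by (rule continuous_on_subset[OF cont]) (use T in auto)
  moreover have "0 < e / (2 * L)" using e(1) L(1) by simp
  ultimately obtain A where A_le: "\<forall>z\<in>A \<inter> Z. \<forall>w\<in>T.
      dist ((\<lambda>(z, w). F z w) (z, w)) ((\<lambda>(z, w). F z w) (z0, w)) \<le> e / (2 * L)"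
    and A: "z0 \<in> A" "open A"
    by (rule continuous_on_prod_compactE[OF _ T(1) z0])
  have "contour_integral \<gamma> (F z) \<in> B" if z: "z \<in> Z" "z \<in> A" for z
  proof -
    have sub: "interior T \<subseteq> S" using T(3) interior_subset by blast
    have int: "F y contour_integrable_on \<gamma>" if "y \<in> Z" for y
      using contour_integrable_holomorphic_simple[OF hol[OF that] S \<gamma>] .
    have "cmod (contour_integral \<gamma> (\<lambda>w. F z w - F z0 w)) \<le> L * (e / (2 * L))"
    proof (rule L(2))
      show "(\<lambda>w. F z w - F z0 w) holomorphic_on interior T"
        using hol z z0 sub by (intro holomorphic_intros) (blast intro: holomorphic_on_subset)+
      show "\<forall>w\<in>interior T. cmod (F z w - F z0 w) \<le> e / (2 * L)"
        using A_le z interior_subset[of T] by (auto simp: dist_norm)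
    qed
    also have "\<dots> < e" using L(1) e(1) by simp
    also have "contour_integral \<gamma> (\<lambda>w. F z w - F z0 w)
        = contour_integral \<gamma> (F z) - contour_integral \<gamma> (F z0)"
      using int z z0 by (intro contour_integral_diff) auto
    finally show ?thesis
      using e(2) by (auto simp: dist_norm norm_minus_commute subset_iff)
  qed
  then show "\<exists>A. open A \<and> z0 \<in> A \<and> (\<forall>y\<in>Z. y \<in> A \<longrightarrow> contour_integral \<gamma> (F y) \<in> B)"
    using A by blast
qed

text \<open>
  If the difference quotients \<open>Q u z\<close> of the integrand are continuous in \<open>z\<close>, passing to the limit
  \<open>z \<longlongrightarrow> u\<close> under the integral gives the derivative \<open>contour_integral \<gamma> (Q u u)\<close>.
\<close>

lemma holomorphic_on_contour_integral_param:
  fixes F :: "complex \<Rightarrow> complex \<Rightarrow> complex"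
  assumes S: "open S" and \<gamma>: "valid_path \<gamma>" "path_image \<gamma> \<subseteq> S" and Z: "open Z"
    and hol: "\<And>z. z \<in> Z \<Longrightarrow> F z holomorphic_on S"
    and quot: "\<And>z u w. z \<in> Z \<Longrightarrow> u \<in> Z \<Longrightarrow> w \<in> S \<Longrightarrow> F z w - F u w = (z - u) * Q u z w"
    and holQ: "\<And>z u. z \<in> Z \<Longrightarrow> u \<in> Z \<Longrightarrow> Q u z holomorphic_on S"
    and contQ: "\<And>u. u \<in> Z \<Longrightarrow> continuous_on (Z \<times> S) (\<lambda>(z, w). Q u z w)"
  shows "(\<lambda>z. contour_integral \<gamma> (F z)) holomorphic_on Z"
proof -
  have "((\<lambda>z. contour_integral \<gamma> (F z)) has_field_derivative contour_integral \<gamma> (Q u u)) (at u)"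
    if u: "u \<in> Z" for u
  proof -
    have "continuous_on Z (\<lambda>z. contour_integral \<gamma> (Q u z))"
      by (rule continuous_on_contour_integral_param[OF S \<gamma> holQ contQ]) (use u in auto)
    then have "((\<lambda>z. contour_integral \<gamma> (Q u z)) \<longlongrightarrow> contour_integral \<gamma> (Q u u)) (at u)"
      using u Z by (simp add: continuous_on_eq_continuous_at isCont_def)
    moreover have "\<forall>\<^sub>F z in at u. contour_integral \<gamma> (Q u z)
        = (contour_integral \<gamma> (F z) - contour_integral \<gamma> (F u)) / (z - u)"
      using eventually_at_in_open[OF Z u]
    proof eventually_elim
      case (elim z)
      have "contour_integral \<gamma> (F z) - contour_integral \<gamma> (F u)
          = contour_integral \<gamma> (\<lambda>w. F z w - F u w)"
        using elim u contour_integrable_holomorphic_simple[OF hol S \<gamma>]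
        by (subst contour_integral_diff) auto
      also have "\<dots> = contour_integral \<gamma> (\<lambda>w. (z - u) * Q u z w)"
        using elim u \<gamma>(2) quot by (intro contour_integral_eq) auto
      also have "\<dots> = (z - u) * contour_integral \<gamma> (Q u z)"
        using elim u contour_integrable_holomorphic_simple[OF holQ S \<gamma>]
        by (intro contour_integral_lmul) auto
      finally show ?case using elim by simp
    qed
    ultimately show ?thesis
      unfolding has_field_derivative_iff by (rule Lim_transform_eventually)
  qed
  then show ?thesis
    using Z holomorphic_on_open by blast
qed

text \<open>
  Dixon's proof. The function \<open>H\<close> below is \<open>\<Sum>\<gamma>. contour_integral \<gamma> (divdiff f z)\<close> on \<open>S\<close>, and
  \<open>\<Sum>\<gamma>. contour_integral \<gamma> (\<lambda>w. f w / (w - z))\<close> outside \<open>K\<close>. Both expressions agree where both make sense,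
  because the total winding number vanishes outside \<open>K\<close>; so \<open>H\<close> is entire. It tends to 0 at infinity, hence is
  0, and at points off the curves \<open>H = 0\<close> is the claimed formula.
\<close>

theorem Cauchy_integral_formula_cycle:
  assumes S: "open S" and f: "f holomorphic_on S"
    and path: "\<And>\<gamma>. \<gamma> \<in> \<Gamma> \<Longrightarrow> valid_path \<gamma>"
    and K: "compact K" "K \<subseteq> S" "\<And>\<gamma>. \<gamma> \<in> \<Gamma> \<Longrightarrow> path_image \<gamma> \<subseteq> K"
    and zero: "\<And>z. z \<notin> K \<Longrightarrow> (\<Sum>\<gamma>\<in>\<Gamma>. winding_number \<gamma> z) = 0"
    and z: "z \<in> S" "\<And>\<gamma>. \<gamma> \<in> \<Gamma> \<Longrightarrow> z \<notin> path_image \<gamma>"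
  shows "(\<Sum>\<gamma>\<in>\<Gamma>. contour_integral \<gamma> (\<lambda>w. f w / (w - z)))
    = 2 * pi * \<i> * (\<Sum>\<gamma>\<in>\<Gamma>. winding_number \<gamma> z) * f z"
proof -
  define H where "H z = (if z \<in> S then (\<Sum>\<gamma>\<in>\<Gamma>. contour_integral \<gamma> (divdiff f z))
      else (\<Sum>\<gamma>\<in>\<Gamma>. contour_integral \<gamma> (\<lambda>w. f w / (w - z))))" for z
  have pS: "path_image \<gamma> \<subseteq> S" if "\<gamma> \<in> \<Gamma>" for \<gamma> using K(2) K(3)[OF that] by blast
  have kern: "(\<lambda>w. f w / (w - z)) contour_integrable_on \<gamma>"
    if "\<gamma> \<in> \<Gamma>" "z \<notin> path_image \<gamma>" for \<gamma> z
    by (rule contour_integrable_holomorphic_simple[of _ "S - {z}"])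
      (use S f path pS that in \<open>auto intro!: holomorphic_intros intro: holomorphic_on_subset\<close>)
  have split: "(\<Sum>\<gamma>\<in>\<Gamma>. contour_integral \<gamma> (divdiff f z))
      = (\<Sum>\<gamma>\<in>\<Gamma>. contour_integral \<gamma> (\<lambda>w. f w / (w - z)))
        - 2 * pi * \<i> * (\<Sum>\<gamma>\<in>\<Gamma>. winding_number \<gamma> z) * f z"
    if "\<And>\<gamma>. \<gamma> \<in> \<Gamma> \<Longrightarrow> z \<notin> path_image \<gamma>" for z
  proof -
    have "contour_integral \<gamma> (divdiff f z) = contour_integral \<gamma> (\<lambda>w. f w / (w - z))
        - 2 * pi * \<i> * winding_number \<gamma> z * f z" if g: "\<gamma> \<in> \<Gamma>" for \<gamma>
    proof -
      have nz: "z \<notin> path_image \<gamma>" using \<open>\<And>\<gamma>. \<gamma> \<in> \<Gamma> \<Longrightarrow> z \<notin> path_image \<gamma>\<close> g .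
      have w: "((\<lambda>w. f z * (1 / (w - z))) has_contour_integral f z * (2 * pi * \<i> * winding_number \<gamma> z)) \<gamma>"
        by (intro has_contour_integral_lmul has_contour_integral_winding_number path g nz)
      have "contour_integral \<gamma> (divdiff f z) = contour_integral \<gamma> (\<lambda>w. f w / (w - z) - f z * (1 / (w - z)))"
        using nz by (intro contour_integral_eq) (auto simp: divdiff_def diff_divide_distrib)
      also have "\<dots> = contour_integral \<gamma> (\<lambda>w. f w / (w - z)) - f z * (2 * pi * \<i> * winding_number \<gamma> z)"
        using w kern[OF g nz] contour_integral_unique[OF w]
        by (subst contour_integral_diff) (auto simp: contour_integrable_on_def)
      finally show ?thesis by (simp add: mult_ac)
    qed
    then show ?thesis by (simp add: sum_subtractf sum_distrib_left sum_distrib_right)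
  qed
  have H_out: "H z = (\<Sum>\<gamma>\<in>\<Gamma>. contour_integral \<gamma> (\<lambda>w. f w / (w - z)))" if "z \<notin> K" for z
    using split[of z] K(3) zero[OF that] that by (auto simp: H_def)
  have "H holomorphic_on S"
  proof -
    have "(\<lambda>z. \<Sum>\<gamma>\<in>\<Gamma>. contour_integral \<gamma> (divdiff f z)) holomorphic_on S"
    proof (intro holomorphic_on_sum holomorphic_on_contour_integral_param[OF S path pS S])
      fix u assume "u \<in> S"
      show "continuous_on (S \<times> S) (\<lambda>(z, w). divdiff (divdiff f u) z w)"
        by (intro continuous_on_divdiff holomorphic_on_divdiff f S)
    qed (use f S in \<open>auto intro: holomorphic_on_divdiff divdiff_diff\<close>)
    then show ?thesis by (rule holomorphic_transform) (auto simp: H_def)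
  qed
  moreover have "H holomorphic_on - K"
  proof -
    have "(\<lambda>z. contour_integral \<gamma> (\<lambda>w. f w / (w - z))) holomorphic_on - K" if g: "\<gamma> \<in> \<Gamma>" for \<gamma>
    proof -
      have "(\<lambda>z. contour_integral \<gamma> (\<lambda>w. f w / (w - z))) field_differentiable at a"
        if a: "a \<in> - K" for a
      proof -
        obtain r where r: "r > 0" "cball a r \<subseteq> - K"
          using a K(1) compact_imp_closed open_contains_cball by (metis open_Compl)
        have ne: "w \<noteq> z" if "w \<in> S - cball a r" "z \<in> ball a r" for w z using that by auto
        have S': "open (S - cball a r)" using S by blast
        have f': "f holomorphic_on S - cball a r" using f by (rule holomorphic_on_subset) auto
        have fc: "continuous_on (ball a r \<times> (S - cball a r)) (\<lambda>p. f (snd p))"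
          by (rule continuous_on_compose2[OF holomorphic_on_imp_continuous_on[OF f']])
            (auto intro: continuous_intros)
        \<comment> \<open>A ball around \<open>a\<close> is cut out of \<open>S\<close>, so that the kernel is holomorphic in \<open>w\<close> on what remains.\<close>
        have "(\<lambda>z. contour_integral \<gamma> (\<lambda>w. f w / (w - z))) holomorphic_on ball a r"
        proof (rule holomorphic_on_contour_integral_param[OF S' path[OF g] _ open_ball,
              where Q = "\<lambda>u z w. f w / ((w - z) * (w - u))"])
          show "path_image \<gamma> \<subseteq> S - cball a r" using r pS[OF g] K(3)[OF g] by blast
        next
          fix u assume "u \<in> ball a r"
          then show "continuous_on (ball a r \<times> (S - cball a r)) (\<lambda>(z, w). f w / ((w - z) * (w - u)))"
            using fc ne unfolding split_beta
            by (auto intro!: continuous_intros)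
        next
          fix z u w assume "z \<in> ball a r" "u \<in> ball a r" "w \<in> S - cball a r"
          then have "w \<noteq> z" "w \<noteq> u" using ne by blast+
          then show "f w / (w - z) - f w / (w - u) = (z - u) * (f w / ((w - z) * (w - u)))"
            by (simp add: divide_simps) (simp add: algebra_simps)
        next
          fix z u assume "z \<in> ball a r" "u \<in> ball a r"
          then show "(\<lambda>w. f w / ((w - z) * (w - u))) holomorphic_on S - cball a r"
            using f' ne by (intro holomorphic_intros) auto
        next
          fix z assume "z \<in> ball a r"
          then show "(\<lambda>w. f w / (w - z)) holomorphic_on S - cball a r"
            using f' ne by (intro holomorphic_intros) auto
        qed
        then show ?thesis
          using r(1) by (meson centre_in_ball holomorphic_on_imp_differentiable_at open_ball)
      qed
      then show ?thesis
        using K(1) by (meson compact_imp_closed field_differentiable_at_within holomorphic_onI)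
    qed
    then have "(\<lambda>z. \<Sum>\<gamma>\<in>\<Gamma>. contour_integral \<gamma> (\<lambda>w. f w / (w - z))) holomorphic_on - K"
      by (intro holomorphic_on_sum) auto
    then show ?thesis by (rule holomorphic_transform) (auto simp: H_out)
  qed
  moreover have "S \<union> - K = UNIV" using K(2) by auto
  ultimately have "H holomorphic_on UNIV"
    using holomorphic_on_Un[of H S "- K"] S K(1) by (auto simp: compact_imp_closed open_Compl)
  moreover have "(H \<longlongrightarrow> 0) at_infinity"
  proof -
    obtain T where T: "compact T" "K \<subseteq> interior T" "T \<subseteq> S"
      using compact_neighbourhood_in_open[OF K(1) S K(2)] .
    have "continuous_on T f"
      using f T(3) holomorphic_on_imp_continuous_on holomorphic_on_subset by blast
    then have "bounded (f ` T)" using T(1) compact_continuous_image compact_imp_bounded by blast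
    then obtain D where D: "D > 0" "\<And>w. w \<in> T \<Longrightarrow> cmod (f w) \<le> D"
      by (auto simp: bounded_pos)
    obtain C where C: "C > 0" "\<And>w. w \<in> T \<Longrightarrow> cmod w \<le> C"
      using T(1) compact_imp_bounded bounded_pos by metis
    have "((\<lambda>z. contour_integral \<gamma> (\<lambda>w. f w / (w - z))) \<longlongrightarrow> 0) at_infinity" if g: "\<gamma> \<in> \<Gamma>" for \<gamma>
    proof -
      have img: "path_image \<gamma> \<subseteq> interior T" using K(3)[OF g] T(2) by blast
      obtain L where L: "L > 0" "\<And>f B. f holomorphic_on interior T \<Longrightarrow>
          \<forall>z\<in>interior T. cmod (f z) \<le> B \<Longrightarrow> cmod (contour_integral \<gamma> f) \<le> L * B"
        using contour_integral_bound_exists[OF open_interior path[OF g] img] by blast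
      show ?thesis
      proof (rule Lim_at_infinityI)
        fix e :: real assume e: "e > 0"
        show "\<exists>B. \<forall>z. cmod z \<ge> B \<longrightarrow> dist (contour_integral \<gamma> (\<lambda>w. f w / (w - z))) 0 \<le> e"
        proof (intro exI allI impI)
          fix z assume z: "C + D * L / e \<le> cmod z"
          have pos: "0 < D * L / e" using D(1) L(1) e by simp
          have far: "D * L / e \<le> cmod (w - z)" if "w \<in> interior T" for w
            using C(2)[of w] that z norm_triangle_ineq2[of z w] interior_subset
            by (force simp: norm_minus_commute)
          then have ne: "w \<noteq> z" if "w \<in> interior T" for w using pos that by fastforce
          \<comment> \<open>Far away from \<open>T\<close> the kernel is at most \<open>D\<close> over the distance to \<open>T\<close>.\<close>
          have "cmod (contour_integral \<gamma> (\<lambda>w. f w / (w - z))) \<le> L * (D / (D * L / e))"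
          proof (rule L(2))
            show "(\<lambda>w. f w / (w - z)) holomorphic_on interior T"
              using f ne T(3) interior_subset
              by (intro holomorphic_intros) (blast intro: holomorphic_on_subset, auto)
            show "\<forall>w\<in>interior T. cmod (f w / (w - z)) \<le> D / (D * L / e)"
            proof
              fix w assume w: "w \<in> interior T"
              then have "cmod (f w) \<le> D" using D(2) interior_subset by blast
              then show "cmod (f w / (w - z)) \<le> D / (D * L / e)"
                unfolding norm_divide using D(1) far[OF w] pos by (intro frac_le) auto
            qed
          qed
          also have "\<dots> = e" using D(1) L(1) by simp
          finally show "dist (contour_integral \<gamma> (\<lambda>w. f w / (w - z))) 0 \<le> e" by simp
        qed
      qed
    qed
    then have "((\<lambda>z. \<Sum>\<gamma>\<in>\<Gamma>. contour_integral \<gamma> (\<lambda>w. f w / (w - z))) \<longlongrightarrow> 0) at_infinity"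
      by (intro tendsto_null_sum) auto
    moreover have "\<forall>\<^sub>F z in at_infinity. (\<Sum>\<gamma>\<in>\<Gamma>. contour_integral \<gamma> (\<lambda>w. f w / (w - z))) = H z"
    proof -
      have "\<forall>\<^sub>F z in at_infinity. z \<notin> K"
        unfolding eventually_at_infinity using C(2) T(2) interior_subset
        by (intro exI[of _ "C + 1"]) force
      then show ?thesis by eventually_elim (simp add: H_out)
    qed
    ultimately show ?thesis by (rule Lim_transform_eventually)
  qed
  ultimately have "H z = 0" by (rule Liouville_weak_0)
  then show ?thesis
    using split[OF z(2)] z(1) by (simp add: H_def)
qed

section \<open>Partial derivatives and functions of class \<open>C\<^sup>k\<close>\<close>

text \<open>
  The partial derivatives are parameters here because \<open>pd_u\<close> and \<open>pd_v\<close> take an unspecified value where no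
  derivative exists.
\<close>

definition has_partials_on ::
  "(complex \<Rightarrow> 'b::real_normed_vector) \<Rightarrow> (complex \<Rightarrow> 'b) \<Rightarrow> (complex \<Rightarrow> 'b) \<Rightarrow> complex set \<Rightarrow> bool"
  where "has_partials_on f fu fv S \<longleftrightarrow> (\<forall>z\<in>S.
    ((\<lambda>t. f (Complex t (Im z))) has_vector_derivative fu z) (at (Re z)) \<and>
    ((\<lambda>t. f (Complex (Re z) t)) has_vector_derivative fv z) (at (Im z)))"

lemma has_partials_on_imp_pd:
  assumes "has_partials_on f fu fv S" "z \<in> S"
  shows "pd_u f z = fu z" "pd_v f z = fv z"
  using assms unfolding has_partials_on_def pd_u_def pd_v_def
  by (auto intro: vector_derivative_at)

lemma eventually_on_lines:
  assumes "open D" "z \<in> D"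
  shows "\<forall>\<^sub>F t in nhds (Re z). Complex t (Im z) \<in> D" "\<forall>\<^sub>F t in nhds (Im z). Complex (Re z) t \<in> D"
proof -
  have c: "((\<lambda>t. Complex t (Im z)) \<longlongrightarrow> Complex (Re z) (Im z)) (nhds (Re z))"
    "((\<lambda>t. Complex (Re z) t) \<longlongrightarrow> Complex (Re z) (Im z)) (nhds (Im z))"
    by (intro tendsto_Complex tendsto_const filterlim_ident)+
  show "\<forall>\<^sub>F t in nhds (Re z). Complex t (Im z) \<in> D" "\<forall>\<^sub>F t in nhds (Im z). Complex (Re z) t \<in> D"
    using assms c by (auto intro: topological_tendstoD)
qed

lemma pd_cong:
  assumes "open D" "\<And>w. w \<in> D \<Longrightarrow> f w = g w" "z \<in> D"
  shows "pd_u f z = pd_u g z" "pd_v f z = pd_v g z"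
  unfolding pd_u_def pd_v_def using assms(2)
  by (auto intro!: vector_derivative_cong_eq eventually_mono[OF eventually_on_lines(1)[OF assms(1,3)]]
      eventually_mono[OF eventually_on_lines(2)[OF assms(1,3)]])

lemma has_partials_on_cong:
  assumes "open D" "\<And>w. w \<in> D \<Longrightarrow> f w = g w" "has_partials_on f fu fv D"
  shows "has_partials_on g fu fv D"
  unfolding has_partials_on_def
proof (intro ballI conjI)
  fix z assume z: "z \<in> D"
  have "\<forall>\<^sub>F t in nhds (Re z). t \<in> UNIV \<longrightarrow> f (Complex t (Im z)) = g (Complex t (Im z))"
    using eventually_on_lines(1)[OF assms(1) z] by eventually_elim (simp add: assms(2))
  then show "((\<lambda>t. g (Complex t (Im z))) has_vector_derivative fu z) (at (Re z))"
    using assms(2)[of z] assms(3) z unfolding has_partials_on_def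
    by (subst has_vector_derivative_cong_ev[where g = "\<lambda>t. f (Complex t (Im z))"])
      (auto elim: eventually_mono)
  have "\<forall>\<^sub>F t in nhds (Im z). t \<in> UNIV \<longrightarrow> f (Complex (Re z) t) = g (Complex (Re z) t)"
    using eventually_on_lines(2)[OF assms(1) z] by eventually_elim (simp add: assms(2))
  then show "((\<lambda>t. g (Complex (Re z) t)) has_vector_derivative fv z) (at (Im z))"
    using assms(2)[of z] assms(3) z unfolding has_partials_on_def
    by (subst has_vector_derivative_cong_ev[where g = "\<lambda>t. f (Complex (Re z) t)"])
      (auto elim: eventually_mono)
qed

lemma class_C_imp_continuous_on: "class_C k D f \<Longrightarrow> continuous_on D f"
  by (cases k) auto

lemma class_C_cong:
  assumes "open D" "\<And>w. w \<in> D \<Longrightarrow> f w = g w" "class_C k D f"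
  shows "class_C k D g"
  using assms(2,3)
proof (induction k arbitrary: f g)
  case 0
  then show ?case by (simp cong: continuous_on_cong)
next
  case (Suc k)
  have p: "has_partials_on f (pd_u f) (pd_v f) D"
    using Suc.prems(2) unfolding has_partials_on_def pd_u_def pd_v_def
    by (simp add: vector_derivative_works[symmetric])
  have "has_partials_on g (pd_u f) (pd_v f) D"
    by (rule has_partials_on_cong[OF assms(1) Suc.prems(1) p])
  then have "\<forall>z\<in>D. (\<lambda>t. g (Complex t (Im z))) differentiable at (Re z) \<and>
              (\<lambda>t. g (Complex (Re z) t)) differentiable at (Im z)"
    unfolding has_partials_on_def by (blast intro: differentiableI_vector)
  moreover have "class_C k D (pd_u g)" "class_C k D (pd_v g)"
    using Suc.prems(2)
    by (auto intro!: Suc.IH[of "pd_u f" "pd_u g"] Suc.IH[of "pd_v f" "pd_v g"]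
        pd_cong[OF assms(1) Suc.prems(1)])
  moreover have "continuous_on D g"
    using Suc.prems by (simp cong: continuous_on_cong)
  ultimately show ?case by simp
qed

lemma class_C_has_partials_on:
  "class_C (Suc k) D f \<Longrightarrow> has_partials_on f (pd_u f) (pd_v f) D"
  unfolding has_partials_on_def pd_u_def pd_v_def
  by (simp add: vector_derivative_works[symmetric])

lemma class_C_SucI:
  assumes "open D" "has_partials_on f fu fv D" "continuous_on D f" "class_C k D fu" "class_C k D fv"
  shows "class_C (Suc k) D f"
proof -
  have "class_C k D (pd_u f)" "class_C k D (pd_v f)"
    using assms(4,5) by (auto intro: class_C_cong[OF assms(1)] simp: has_partials_on_imp_pd[OF assms(2)])
  then show ?thesis
    using assms(2,3) unfolding has_partials_on_def class_C.simps by (blast intro: differentiableI_vector)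
qed

lemma class_C_Suc_imp: "class_C (Suc k) D f \<Longrightarrow> class_C k D f"
proof (induction k arbitrary: f)
  case 0
  then show ?case by simp
next
  case (Suc k)
  have f: "class_C (Suc k) D (pd_u f)" "class_C (Suc k) D (pd_v f)"
    using Suc.prems by (simp_all only: class_C.simps(2)[of "Suc k"])
  show ?case
    using Suc.prems f[THEN Suc.IH] unfolding class_C.simps(2) by blast
qed

lemma class_C_antimono:
  assumes "k \<le> m" "class_C m D f"
  shows "class_C k D f"
  using assms by (induction m rule: dec_induct) (simp_all add: class_C_Suc_imp del: class_C.simps)

lemma has_partials_on_linear:
  assumes "bounded_linear L" "has_partials_on f fu fv D"
  shows "has_partials_on (\<lambda>z. L (f z)) (\<lambda>z. L (fu z)) (\<lambda>z. L (fv z)) D"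
  using assms(2) unfolding has_partials_on_def
  by (simp add: bounded_linear.has_vector_derivative[OF assms(1)])

lemma has_partials_on_add:
  assumes "has_partials_on f fu fv D" "has_partials_on g gu gv D"
  shows "has_partials_on (\<lambda>z. f z + g z) (\<lambda>z. fu z + gu z) (\<lambda>z. fv z + gv z) D"
  using assms unfolding has_partials_on_def by (auto intro!: has_vector_derivative_add)

lemma class_C_linear:
  assumes "open D" "bounded_linear L" "class_C k D f"
  shows "class_C k D (\<lambda>z. L (f z))"
  using assms(3)
proof (induction k arbitrary: f)
  case 0
  then show ?case using bounded_linear.continuous_on[OF assms(2)] by simp
next
  case (Suc k)
  have "continuous_on D (\<lambda>z. L (f z))"
    by (rule bounded_linear.continuous_on[OF assms(2) class_C_imp_continuous_on[OF Suc.prems]])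
  moreover have "class_C k D (\<lambda>z. L (pd_u f z))" "class_C k D (\<lambda>z. L (pd_v f z))"
    using Suc.prems by (simp_all add: Suc.IH)
  ultimately show ?case
    by (rule class_C_SucI[OF assms(1)
          has_partials_on_linear[OF assms(2) class_C_has_partials_on[OF Suc.prems]]])
qed

lemma class_C_add:
  assumes "open D" "class_C k D f" "class_C k D g"
  shows "class_C k D (\<lambda>z. f z + g z)"
  using assms(2,3)
proof (induction k arbitrary: f g)
  case 0
  then show ?case by (simp add: continuous_on_add)
next
  case (Suc k)
  have "continuous_on D (\<lambda>z. f z + g z)"
    using Suc.prems by (simp add: continuous_on_add)
  moreover have "class_C k D (\<lambda>z. pd_u f z + pd_u g z)" "class_C k D (\<lambda>z. pd_v f z + pd_v g z)"
    using Suc.prems by (simp_all add: Suc.IH)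
  ultimately show ?case
    by (rule class_C_SucI[OF assms(1) has_partials_on_add[OF
            class_C_has_partials_on[OF Suc.prems(1)] class_C_has_partials_on[OF Suc.prems(2)]]])
qed

text \<open>
  The continuity of one partial derivative makes \<open>f\<close> differentiable as a function of two real variables, and
  the Cauchy-Riemann equation makes the derivative complex linear.
\<close>

lemma holomorphic_on_if_partials:
  fixes f :: "complex \<Rightarrow> complex"
  assumes "open S" "has_partials_on f fu fv S" "continuous_on S fv"
    and CR: "\<And>z. z \<in> S \<Longrightarrow> fu z + \<i> * fv z = 0"
  shows "f holomorphic_on S"
proof -
  have "(f has_field_derivative fu a) (at a)" if a: "a \<in> S" for a
  proof -
    have "open ((\<lambda>p. Complex (fst p) (snd p)) -` S)"
      using assms(1) by (intro open_vimage continuous_intros)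
    then obtain X Y where XY: "open X" "open Y" "(Re a, Im a) \<in> X \<times> Y"
        "X \<times> Y \<subseteq> (\<lambda>p. Complex (fst p) (snd p)) -` S"
      using a by (elim open_prod_elim[where x = "(Re a, Im a)"]) auto
    then obtain r where r: "r > 0" "ball (Im a) r \<subseteq> Y"
      using openE[of Y "Im a"] by auto
    define B where "B = ball (Im a) r"
    have sub: "Complex x y \<in> S" if "x \<in> X" "y \<in> B" for x y
      using XY(4) that r(2) unfolding B_def by (auto simp: subset_iff)
    have in_XB: "Re a \<in> X" "Im a \<in> B" using XY r by (auto simp: B_def)
    have "((\<lambda>(x, y). f (Complex x y)) has_derivative
        (\<lambda>(tx, ty). tx *\<^sub>R fu a + blinfun_scaleR_left (fv (Complex (Re a) (Im a))) ty))
        (at (Re a, Im a) within X \<times> B)"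
    proof (rule has_derivative_partialsI[where fy = "\<lambda>x y. blinfun_scaleR_left (fv (Complex x y))"])
      show "((\<lambda>x. f (Complex x (Im a))) has_derivative (\<lambda>tx. tx *\<^sub>R fu a)) (at (Re a) within X)"
        using assms(2) a unfolding has_partials_on_def has_vector_derivative_def
        by (auto intro: has_derivative_at_withinI)
      show "((\<lambda>y. f (Complex x y)) has_derivative blinfun_apply (blinfun_scaleR_left (fv (Complex x y))))
          (at y within B)" if "x \<in> X" "y \<in> B" for x y
      proof -
        have "((\<lambda>t. f (Complex x t)) has_vector_derivative fv (Complex x y)) (at y)"
          using assms(2)[unfolded has_partials_on_def, rule_format, OF sub[OF that]] by simp
        then show ?thesis
          by (simp add: has_vector_derivative_def has_derivative_at_withinI)
      qed
      have "continuous_on (X \<times> B) (\<lambda>p. blinfun_scaleR_left (fv (Complex (fst p) (snd p))))"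
        using sub
        by (intro bounded_linear.continuous_on[OF bounded_linear_blinfun_scaleR_left]
            continuous_on_compose2[OF assms(3)] continuous_intros) auto
      then show "continuous (at (Re a, Im a) within X \<times> B)
          (\<lambda>(x, y). blinfun_scaleR_left (fv (Complex x y)))"
        using in_XB unfolding split_beta continuous_on_eq_continuous_within by blast
    qed (use in_XB in \<open>auto simp: B_def\<close>)
    moreover have "open (X \<times> B)" using XY(1) by (auto simp: B_def intro: open_Times)
    ultimately have "((\<lambda>(x, y). f (Complex x y)) has_derivative
        (\<lambda>(tx, ty). tx *\<^sub>R fu a + ty *\<^sub>R fv a)) (at (Re a, Im a))"
      using in_XB by (simp add: at_within_open[of _ "X \<times> B"])
    moreover have "((\<lambda>z. (Re z, Im z)) has_derivative (\<lambda>z. (Re z, Im z))) (at a)"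
      by (intro derivative_intros)
    ultimately have "((\<lambda>z. case (Re z, Im z) of (x, y) \<Rightarrow> f (Complex x y)) has_derivative
        (\<lambda>z. case (Re z, Im z) of (tx, ty) \<Rightarrow> tx *\<^sub>R fu a + ty *\<^sub>R fv a)) (at a)"
      by (rule has_derivative_compose[rotated])
    then have "(f has_derivative (\<lambda>z. Re z *\<^sub>R fu a + Im z *\<^sub>R fv a)) (at a)"
      by simp
    moreover have "fv a = \<i> * fu a"
      using CR[OF a] by (simp add: complex_eq_iff)
    then have "(\<lambda>z. Re z *\<^sub>R fu a + Im z *\<^sub>R fv a) = (*) (fu a)"
      by (auto simp: fun_eq_iff complex_eq_iff algebra_simps)
    ultimately show ?thesis by (simp add: has_field_derivative_def)
  qed
  then show ?thesis using assms(1) holomorphic_on_open by blast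
qed

section \<open>Poly-analytic functions for a complex structure on a real vector space\<close>

text \<open>
  The components of the slice Cauchy kernel, regarded as a slice function of \<open>x\<close>: with \<open>z = u + i v\<close>, the first
  is even and the second is odd in \<open>v\<close>.
\<close>

definition kernel_even :: "complex \<Rightarrow> complex \<Rightarrow> complex"
  where "kernel_even z s = (1 / (s - z) + 1 / (s - cnj z)) / 2"

definition kernel_odd :: "complex \<Rightarrow> complex \<Rightarrow> complex"
  where "kernel_odd z s = (1 / (s - z) - 1 / (s - cnj z)) / (2 * \<i>)"

text \<open>
  The vector space becomes complex, with \<open>J\<close> as multiplication by \<open>\<i>\<close>. Left and right multiplication by an
  imaginary unit of the Clifford algebra are the two instances of interest.
\<close>

locale complex_structure =
  fixes J :: "'b::euclidean_space \<Rightarrow> 'b"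
  assumes linear_J: "linear J" and J_J: "J (J y) = - y"
begin

lemma bounded_linear_J: "bounded_linear J"
  using linear_J by (simp add: linear_conv_bounded_linear)

lemma J_simps: "J (x + y) = J x + J y" "J (x - y) = J x - J y" "J (r *\<^sub>R x) = r *\<^sub>R J x" "J (- x) = - J x" "J 0 = 0"
  using linear_J by (simp_all add: linear_add linear_diff linear_cmul linear_neg linear_0)

definition cmul :: "complex \<Rightarrow> 'b \<Rightarrow> 'b"
  where "cmul a y = Re a *\<^sub>R y + Im a *\<^sub>R J y"

lemma cmul_add_left: "cmul (a + b) y = cmul a y + cmul b y"
  by (simp add: cmul_def algebra_simps)

lemma cmul_diff_left: "cmul (a - b) y = cmul a y - cmul b y"
  by (simp add: cmul_def algebra_simps)

lemma cmul_add_right: "cmul a (x + y) = cmul a x + cmul a y"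
  by (simp add: cmul_def J_simps algebra_simps)

lemma cmul_diff_right: "cmul a (x - y) = cmul a x - cmul a y"
  by (simp add: cmul_def J_simps algebra_simps)

lemma cmul_cmul: "cmul a (cmul b y) = cmul (a * b) y"
  by (simp add: cmul_def J_simps J_J algebra_simps)

lemma bounded_linear_cmul: "bounded_linear (cmul a)"
proof -
  have "linear (cmul a)"
    by (rule linearI) (simp_all add: cmul_def J_simps algebra_simps)
  then show ?thesis by (simp add: linear_conv_bounded_linear)
qed

text \<open>
  The complex linear functional whose real part is the inner product with \<open>c\<close>. These functionals separate
  points, so that integrals of vector-valued functions can be computed with complex-valued functions.
\<close>

definition coord :: "'b \<Rightarrow> 'b \<Rightarrow> complex"
  where "coord c y = Complex (y \<bullet> c) (- (J y \<bullet> c))"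

lemma bounded_linear_coord: "bounded_linear (coord c)"
proof -
  have "linear (coord c)"
    by (rule linearI) (simp_all add: coord_def J_simps inner_add_left complex_eq_iff)
  then show ?thesis by (simp add: linear_conv_bounded_linear)
qed

lemma coord_cmul: "coord c (cmul a y) = a * coord c y"
  by (simp add: coord_def cmul_def J_simps J_J complex_eq_iff algebra_simps)

lemma Re_coord: "Re (coord c y) = y \<bullet> c"
  by (simp add: coord_def)

lemma coord_J: "coord c (J y) = \<i> * coord c y"
  by (simp add: coord_def J_J complex_eq_iff)

lemma holomorphic_on_coord:
  assumes "open S" "has_partials_on h hu hv S" "continuous_on S hv"
    and CR: "\<And>z. z \<in> S \<Longrightarrow> hu z + J (hv z) = 0"
  shows "(\<lambda>z. coord c (h z)) holomorphic_on S"
proof (rule holomorphic_on_if_partials[OF assms(1)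
      has_partials_on_linear[OF bounded_linear_coord assms(2)]
      bounded_linear.continuous_on[OF bounded_linear_coord assms(3)]])
  fix z assume "z \<in> S"
  then have "coord c (hu z + J (hv z)) = 0"
    using CR linear_0[OF bounded_linear.linear[OF bounded_linear_coord]] by simp
  then show "coord c (hu z) + \<i> * coord c (hv z) = 0"
    by (simp add: linear_add[OF bounded_linear.linear[OF bounded_linear_coord]] coord_J)
qed

definition cauchy_integrand :: "(complex \<Rightarrow> 'b) \<Rightarrow> complex \<Rightarrow> (real \<Rightarrow> complex) \<Rightarrow> real \<Rightarrow> 'b"
  where "cauchy_integrand h w \<gamma> t =
    cmul (vector_derivative \<gamma> (at t within {0..1}) / (\<gamma> t - w)) (h (\<gamma> t))"

lemma has_integral_cauchy_integrand_inner:
  assumes S: "open S" and hol: "\<And>c. (\<lambda>z. coord c (h z)) holomorphic_on S"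
    and \<gamma>: "valid_path \<gamma>" "path_image \<gamma> \<subseteq> S" "w \<notin> path_image \<gamma>"
  shows "((\<lambda>t. cauchy_integrand h w \<gamma> t \<bullet> c) has_integral
    Re (contour_integral \<gamma> (\<lambda>s. coord c (h s) / (s - w)))) {0..1}"
proof -
  have "(\<lambda>s. coord c (h s) / (s - w)) contour_integrable_on \<gamma>"
    by (rule contour_integrable_holomorphic_simple[of _ "S - {w}"])
      (use S \<gamma> holomorphic_on_subset[OF hol[of c]] in \<open>auto intro!: holomorphic_intros\<close>)
  then have "((\<lambda>t. coord c (h (\<gamma> t)) / (\<gamma> t - w) * vector_derivative \<gamma> (at t within {0..1}))
      has_integral contour_integral \<gamma> (\<lambda>s. coord c (h s) / (s - w))) {0..1}"
    using has_contour_integral_integral unfolding has_contour_integral_def by blast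
  then have "((\<lambda>t. coord c (cauchy_integrand h w \<gamma> t)) has_integral
      contour_integral \<gamma> (\<lambda>s. coord c (h s) / (s - w))) {0..1}"
    by (simp add: cauchy_integrand_def coord_cmul mult_ac)
  from has_integral_linear[OF this bounded_linear_Re] show ?thesis
    by (simp add: o_def Re_coord)
qed

text \<open>
  Each functional \<open>coord c\<close> turns \<open>h\<close> into a holomorphic function, to which the scalar formula applies; the
  real parts of the results are the components of the vector integral. Integrability also comes from the
  components, whose integrands are holomorphic along the path, and not from a bound on the derivative of the
  path.
\<close>

theorem cauchy_formula_cycle:
  assumes S: "open S" and h: "has_partials_on h hu hv S" "continuous_on S hv"
    and CR: "\<And>z. z \<in> S \<Longrightarrow> hu z + J (hv z) = 0"
    and path: "\<And>\<gamma>. \<gamma> \<in> \<Gamma> \<Longrightarrow> valid_path \<gamma>"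
    and K: "compact K" "K \<subseteq> S" "\<And>\<gamma>. \<gamma> \<in> \<Gamma> \<Longrightarrow> path_image \<gamma> \<subseteq> K"
    and zero: "\<And>z. z \<notin> K \<Longrightarrow> (\<Sum>\<gamma>\<in>\<Gamma>. winding_number \<gamma> z) = 0"
    and w: "w \<in> S" "\<And>\<gamma>. \<gamma> \<in> \<Gamma> \<Longrightarrow> w \<notin> path_image \<gamma>"
  shows "\<gamma> \<in> \<Gamma> \<Longrightarrow> cauchy_integrand h w \<gamma> integrable_on {0..1}"
    and "(\<Sum>\<gamma>\<in>\<Gamma>. integral {0..1} (cauchy_integrand h w \<gamma>))
      = cmul (2 * pi * \<i> * (\<Sum>\<gamma>\<in>\<Gamma>. winding_number \<gamma> w)) (h w)"
proof -
  have hol: "(\<lambda>z. coord c (h z)) holomorphic_on S" for c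
    by (rule holomorphic_on_coord[OF S h CR])
  have pS: "path_image \<gamma> \<subseteq> S" if "\<gamma> \<in> \<Gamma>" for \<gamma> using K(2) K(3)[OF that] by blast
  have comp: "((\<lambda>t. cauchy_integrand h w \<gamma> t \<bullet> c) has_integral
      Re (contour_integral \<gamma> (\<lambda>s. coord c (h s) / (s - w)))) {0..1}" if g: "\<gamma> \<in> \<Gamma>" for \<gamma> c
    by (rule has_integral_cauchy_integrand_inner[OF S hol path[OF g] pS[OF g] w(2)[OF g]])
  have int: "cauchy_integrand h w \<gamma> integrable_on {0..1}" if "\<gamma> \<in> \<Gamma>" for \<gamma>
    by (rule integrable_componentwise, rule has_integral_integrable[OF comp[OF that]])
  then show "\<gamma> \<in> \<Gamma> \<Longrightarrow> cauchy_integrand h w \<gamma> integrable_on {0..1}" .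
  have eq: "(\<Sum>\<gamma>\<in>\<Gamma>. integral {0..1} (cauchy_integrand h w \<gamma>)) \<bullet> c
      = cmul (2 * pi * \<i> * (\<Sum>\<gamma>\<in>\<Gamma>. winding_number \<gamma> w)) (h w) \<bullet> c" for c
  proof -
    have "(\<Sum>\<gamma>\<in>\<Gamma>. integral {0..1} (cauchy_integrand h w \<gamma>)) \<bullet> c
        = (\<Sum>\<gamma>\<in>\<Gamma>. integral {0..1} (cauchy_integrand h w \<gamma>) \<bullet> c)"
      by (rule inner_sum_left)
    also have "\<dots> = (\<Sum>\<gamma>\<in>\<Gamma>. Re (contour_integral \<gamma> (\<lambda>s. coord c (h s) / (s - w))))"
    proof (intro sum.cong refl)
      fix \<gamma> assume g: "\<gamma> \<in> \<Gamma>"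
      show "integral {0..1} (cauchy_integrand h w \<gamma>) \<bullet> c
          = Re (contour_integral \<gamma> (\<lambda>s. coord c (h s) / (s - w)))"
        by (simp only: integral_component_eq[OF int[OF g], symmetric] integral_unique[OF comp[OF g]])
    qed
    also have "\<dots> = Re (\<Sum>\<gamma>\<in>\<Gamma>. contour_integral \<gamma> (\<lambda>s. coord c (h s) / (s - w)))"
      by (rule Re_sum[symmetric])
    also have "(\<Sum>\<gamma>\<in>\<Gamma>. contour_integral \<gamma> (\<lambda>s. coord c (h s) / (s - w)))
        = 2 * pi * \<i> * (\<Sum>\<gamma>\<in>\<Gamma>. winding_number \<gamma> w) * coord c (h w)"
      by (rule Cauchy_integral_formula_cycle[OF S hol path K zero w])
    also have "Re (2 * pi * \<i> * (\<Sum>\<gamma>\<in>\<Gamma>. winding_number \<gamma> w) * coord c (h w))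
        = cmul (2 * pi * \<i> * (\<Sum>\<gamma>\<in>\<Gamma>. winding_number \<gamma> w)) (h w) \<bullet> c"
      by (simp only: coord_cmul[symmetric] Re_coord)
    finally show ?thesis .
  qed
  show "(\<Sum>\<gamma>\<in>\<Gamma>. integral {0..1} (cauchy_integrand h w \<gamma>))
      = cmul (2 * pi * \<i> * (\<Sum>\<gamma>\<in>\<Gamma>. winding_number \<gamma> w)) (h w)"
    by (rule euclidean_eqI, rule eq)
qed

definition dbar :: "(complex \<Rightarrow> 'b) \<Rightarrow> complex \<Rightarrow> 'b"
  where "dbar f z = (1/2) *\<^sub>R (pd_u f z + J (pd_v f z))"

lemma dbar_funpow_cong:
  assumes "open D" "\<And>w. w \<in> D \<Longrightarrow> f w = g w" "z \<in> D"
  shows "(dbar ^^ l) f z = (dbar ^^ l) g z"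
  using assms(3)
proof (induction l arbitrary: z)
  case 0
  then show ?case using assms(2) by simp
next
  case (Suc l)
  then show ?case
    by (simp add: dbar_def[of "(dbar ^^ l) f"] dbar_def[of "(dbar ^^ l) g"] pd_cong[OF assms(1) Suc.IH])
qed

lemma class_C_dbar:
  assumes "open D" "class_C (Suc k) D f"
  shows "class_C k D (dbar f)"
proof -
  have "class_C k D (pd_u f)" "class_C k D (pd_v f)" using assms(2) by simp_all
  then have "class_C k D (\<lambda>z. (1/2) *\<^sub>R (pd_u f z + J (pd_v f z)))"
    using assms(1) by (intro class_C_linear[OF _ bounded_linear_scaleR_right] class_C_add
        class_C_linear[OF _ bounded_linear_J])
  then show ?thesis by (simp add: dbar_def[abs_def])
qed

lemma class_C_dbar_funpow:
  assumes "open D" "class_C M D f" "l \<le> M"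
  shows "class_C (M - l) D ((dbar ^^ l) f)"
  using assms(3)
proof (induction l)
  case (Suc l)
  then have "class_C (Suc (M - Suc l)) D ((dbar ^^ l) f)"
    by (simp add: Suc_diff_Suc del: class_C.simps)
  from class_C_dbar[OF assms(1) this] show ?case by simp
qed (use assms in simp)

text \<open>
  A poly-analytic function is a polynomial in \<open>Re s - a\<close> with holomorphic coefficients; this sum extracts the
  coefficient of degree 0.
\<close>

definition holomorphic_part :: "nat \<Rightarrow> real \<Rightarrow> (complex \<Rightarrow> 'b) \<Rightarrow> complex \<Rightarrow> 'b"
  where "holomorphic_part M a f s = (\<Sum>l<M. ((- 2 * (Re s - a)) ^ l / fact l) *\<^sub>R (dbar ^^ l) f s)"

lemma holomorphic_part_at:
  assumes "M \<ge> 1" "Re s = a"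
  shows "holomorphic_part M a f s = f s"
proof -
  have "holomorphic_part M a f s = (\<Sum>l<M. if l = 0 then f s else 0)"
    unfolding holomorphic_part_def using assms(2) by (intro sum.cong) (auto simp: power_0_left)
  then show ?thesis using assms(1) by simp
qed

text \<open>
  With \<open>c l = (- 2 (Re s - a)) ^ l / l!\<close> one has \<open>\<partial>\<^sub>u (c l) = - 2 c (l - 1)\<close>, so the Cauchy-Riemann operator
  \<open>\<partial>\<^sub>u + J \<partial>\<^sub>v\<close> sends the \<open>l\<close>-th summand to
  \<open>2 c l dbar\<^sup>l\<^sup>+\<^sup>1 f - 2 c (l - 1) dbar\<^sup>l f\<close>, without the last term for \<open>l = 0\<close>, and the sum telescopes to \<open>2 c (M - 1) dbar\<^sup>M f = 0\<close>.
\<close>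

lemma holomorphic_part_CR:
  assumes S: "open S" and f: "class_C M S f" and zero: "\<And>z. z \<in> S \<Longrightarrow> (dbar ^^ M) f z = 0"
  obtains hu hv where "has_partials_on (holomorphic_part M a f) hu hv S" "continuous_on S hv"
    "\<And>z. z \<in> S \<Longrightarrow> hu z + J (hv z) = 0"
proof
  define g where "g l = (dbar ^^ l) f" for l
  define c where "c l u = (- 2 * (u - a)) ^ l / fact l" for l u
  define c' where "c' l u = (if l = 0 then 0 else - 2 * c (l - 1) u)" for l u
  define hu where "hu z = (\<Sum>l<M. c l (Re z) *\<^sub>R pd_u (g l) z + c' l (Re z) *\<^sub>R g l z)" for z
  define hv where "hv z = (\<Sum>l<M. c l (Re z) *\<^sub>R pd_v (g l) z)" for z
  have h: "holomorphic_part M a f = (\<lambda>z. \<Sum>l<M. c l (Re z) *\<^sub>R g l z)"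
    by (simp add: fun_eq_iff holomorphic_part_def c_def g_def)
  have g1: "class_C (Suc 0) S (g l)" if "l < M" for l
  proof -
    have "Suc 0 \<le> M - l" "l \<le> M" using that by simp_all
    then show ?thesis
      unfolding g_def by (rule class_C_antimono[OF _ class_C_dbar_funpow[OF S f]])
  qed
  have gp: "has_partials_on (g l) (pd_u (g l)) (pd_v (g l)) S" if "l < M" for l
    by (rule class_C_has_partials_on[OF g1[OF that]])
  have c_der: "(c l has_real_derivative c' l u) (at u)" for l u
  proof (cases l)
    case 0
    then show ?thesis by (simp add: c_def[abs_def] c'_def)
  next
    case (Suc k)
    have "(c l has_real_derivative (real (Suc k) * (- 2 * (u - a)) ^ k * (- 2)) / fact (Suc k)) (at u)"
      unfolding c_def[abs_def] Suc by (rule derivative_eq_intros refl | simp)+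
    moreover have "(real (Suc k) * (- 2 * (u - a)) ^ k * (- 2)) / fact (Suc k) = c' l u"
      by (simp add: c'_def c_def Suc divide_simps)
    ultimately show ?thesis by simp
  qed
  show "has_partials_on (holomorphic_part M a f) hu hv S"
    unfolding has_partials_on_def h hu_def hv_def
  proof (intro ballI conjI has_vector_derivative_sum)
    fix z l assume z: "z \<in> S" and "l \<in> {..<M}"
    then have l: "l < M" by simp
    show "((\<lambda>t. c l (Re (Complex t (Im z))) *\<^sub>R g l (Complex t (Im z))) has_vector_derivative
        c l (Re z) *\<^sub>R pd_u (g l) z + c' l (Re z) *\<^sub>R g l z) (at (Re z))"
      using has_vector_derivative_scaleR[OF c_der[of l "Re z"],
          of "\<lambda>t. g l (Complex t (Im z))" "pd_u (g l) z"] gp[OF l] z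
      by (simp add: has_partials_on_def)
    show "((\<lambda>t. c l (Re (Complex (Re z) t)) *\<^sub>R g l (Complex (Re z) t)) has_vector_derivative
        c l (Re z) *\<^sub>R pd_v (g l) z) (at (Im z))"
      using bounded_linear.has_vector_derivative[OF bounded_linear_scaleR_right[of "c l (Re z)"],
          of "\<lambda>t. g l (Complex (Re z) t)" "pd_v (g l) z"] gp[OF l] z
      by (simp add: has_partials_on_def)
  qed
  show "continuous_on S hv"
    unfolding hv_def[abs_def]
  proof (rule continuous_on_sum)
    fix l assume "l \<in> {..<M}"
    then have "continuous_on S (pd_v (g l))"
      using g1[of l] by simp
    moreover have "continuous_on S (\<lambda>z. c l (Re z))"
      unfolding c_def by (intro continuous_intros) auto
    ultimately show "continuous_on S (\<lambda>z. c l (Re z) *\<^sub>R pd_v (g l) z)"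
      by (rule continuous_on_scaleR[rotated])
  qed
  show "hu z + J (hv z) = 0" if z: "z \<in> S" for z
  proof -
    define T where "T l = - (c' l (Re z) *\<^sub>R g l z)" for l
    have g_Suc: "pd_u (g l) z + J (pd_v (g l) z) = 2 *\<^sub>R g (Suc l) z" for l
      by (simp add: g_def dbar_def)
    have "hu z + J (hv z) = (\<Sum>l<M. c l (Re z) *\<^sub>R (pd_u (g l) z + J (pd_v (g l) z)) + c' l (Re z) *\<^sub>R g l z)"
      unfolding hu_def hv_def linear_sum[OF linear_J] J_simps sum.distrib[symmetric]
      by (intro sum.cong refl) (simp add: algebra_simps)
    also have "\<dots> = (\<Sum>l<M. T (Suc l) - T l)"
      by (intro sum.cong refl) (simp only: g_Suc, simp add: T_def c'_def)
    also have "\<dots> = T M - T 0"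
      by (rule sum_lessThan_telescope)
    also have "\<dots> = 0"
      using zero[OF z] by (simp add: T_def c'_def g_def)
    finally show ?thesis .
  qed
qed

text \<open>
  Pulling the powers of 2 out of \<open>pd_u\<close> and \<open>pd_v\<close> uses that the derivatives exist, since the unspecified
  values of these operators need not scale; hence the bound \<open>l \<le> M\<close>.
\<close>

lemma cr_funpow_eq_dbar_funpow:
  assumes cr: "\<And>f z. cr f z = pd_u f z + J (pd_v f z)"
    and S: "open S" and f: "class_C M S f" and "l \<le> M" "z \<in> S"
  shows "(cr ^^ l) f z = 2 ^ l *\<^sub>R (dbar ^^ l) f z"
  using assms(4,5)
proof (induction l arbitrary: z)
  case 0
  then show ?case by simp
next
  case (Suc l)
  define g where "g = (dbar ^^ l) f"
  have "class_C (Suc (M - Suc l)) S g"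
    using class_C_dbar_funpow[OF S f, of l] Suc.prems
    by (simp add: g_def Suc_diff_Suc del: class_C.simps)
  then have "has_partials_on g (pd_u g) (pd_v g) S"
    by (rule class_C_has_partials_on)
  then have "has_partials_on (\<lambda>w. 2 ^ l *\<^sub>R g w) (\<lambda>w. 2 ^ l *\<^sub>R pd_u g w) (\<lambda>w. 2 ^ l *\<^sub>R pd_v g w) S"
    by (rule has_partials_on_linear[OF bounded_linear_scaleR_right])
  note pd = has_partials_on_imp_pd[OF this Suc.prems(2)]
  have eq: "(cr ^^ l) f w = 2 ^ l *\<^sub>R g w" if "w \<in> S" for w
    using Suc that by (simp add: g_def)
  have "(cr ^^ Suc l) f z = pd_u (\<lambda>w. 2 ^ l *\<^sub>R g w) z + J (pd_v (\<lambda>w. 2 ^ l *\<^sub>R g w) z)"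
    by (simp add: cr pd_cong[OF S eq Suc.prems(2)])
  also have "\<dots> = 2 ^ l *\<^sub>R (pd_u g z + J (pd_v g z))"
    by (simp add: pd J_simps scaleR_add_right)
  also have "\<dots> = 2 ^ Suc l *\<^sub>R dbar g z"
    by (simp add: dbar_def)
  finally show ?case by (simp add: g_def)
qed

text \<open>
  The integrand common to the left and the right formula. The map \<open>R\<close> is multiplication by the imaginary unit of
  the slice that contains \<open>x\<close>, and \<open>- \<i> * d\<close> is the density of \<open>ds (-j)\<close>.
\<close>

definition slice_integrand ::
  "('b \<Rightarrow> 'b) \<Rightarrow> (complex \<Rightarrow> 'b) \<Rightarrow> complex \<Rightarrow> (real \<Rightarrow> complex) \<Rightarrow> real \<Rightarrow> 'b"
  where "slice_integrand R h z \<gamma> t =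
    (let d = vector_derivative \<gamma> (at t within {0..1}) in
      cmul (kernel_even z (\<gamma> t) * (- \<i> * d)) (h (\<gamma> t)) +
      R (cmul (kernel_odd z (\<gamma> t) * (- \<i> * d)) (h (\<gamma> t))))"

text \<open>
  The two kernels are combinations of \<open>1/(s - z)\<close> and \<open>1/(s - cnj z)\<close>, so the integral is a combination of
  Cauchy integrals of \<open>h\<close> at \<open>z\<close> and at \<open>cnj z\<close>. Both points have real part \<open>Re z\<close>, where \<open>h\<close> equals \<open>f\<close>.
\<close>

theorem poly_slice_cauchy_formula:
  assumes S: "open S" and f: "class_C M S f" and zero: "\<And>z. z \<in> S \<Longrightarrow> (dbar ^^ M) f z = 0"
    and M: "M \<ge> 1" and R: "linear R"
    and D: "open D" "bounded D" "closure D \<subseteq> S" and \<Gamma>: "positive_boundary \<Gamma> D"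
    and z: "z \<in> D" "cnj z \<in> D"
  defines "h \<equiv> holomorphic_part M (Re z) f"
  shows "\<gamma> \<in> \<Gamma> \<Longrightarrow> slice_integrand R h z \<gamma> integrable_on {0..1}"
    and "(\<Sum>\<gamma>\<in>\<Gamma>. integral {0..1} (slice_integrand R h z \<gamma>))
      = pi *\<^sub>R (f z + f (cnj z)) - pi *\<^sub>R R (J (f z - f (cnj z)))"
proof -
  obtain hu hv where h: "has_partials_on h hu hv S" "continuous_on S hv"
      "\<And>z. z \<in> S \<Longrightarrow> hu z + J (hv z) = 0"
    unfolding h_def using holomorphic_part_CR[OF S f zero] by metis
  have path: "valid_path \<gamma>" and img: "path_image \<gamma> \<subseteq> frontier D" if "\<gamma> \<in> \<Gamma>" for \<gamma>
    using \<Gamma> that unfolding positive_boundary_def by blast+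
  have img': "path_image \<gamma> \<subseteq> closure D" if "\<gamma> \<in> \<Gamma>" for \<gamma>
    using img[OF that] by (auto simp: frontier_def)
  have out: "(\<Sum>\<gamma>\<in>\<Gamma>. winding_number \<gamma> w) = 0" if "w \<notin> closure D" for w
    using \<Gamma> that unfolding positive_boundary_def by blast
  have inn: "(\<Sum>\<gamma>\<in>\<Gamma>. winding_number \<gamma> w) = 1" if "w \<in> D" for w
    using \<Gamma> that unfolding positive_boundary_def by blast
  have ni: "w \<notin> path_image \<gamma>" if "w \<in> D" "\<gamma> \<in> \<Gamma>" for w \<gamma>
    using img[OF that(2)] that(1) D(1) by (auto simp: frontier_def interior_open)
  have wS: "w \<in> S" if "w \<in> D" for w
    using that D(3) closure_subset by blast
  define I where "I w \<gamma> = integral {0..1} (cauchy_integrand h w \<gamma>)" for w \<gamma>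
  have cK: "compact (closure D)" using D(2) by simp
  have I: "(cauchy_integrand h w \<gamma> has_integral I w \<gamma>) {0..1}" if "w \<in> D" "\<gamma> \<in> \<Gamma>" for w \<gamma>
    unfolding I_def
    by (rule integrable_integral,
        rule cauchy_formula_cycle(1)[OF S h path cK D(3) img' out wS[OF that(1)] ni[OF that(1)] that(2)])
  have sum_I: "(\<Sum>\<gamma>\<in>\<Gamma>. I w \<gamma>) = cmul (2 * pi * \<i>) (h w)" if "w \<in> D" for w
    unfolding I_def
    using cauchy_formula_cycle(2)[OF S h path cK D(3) img' out wS[OF that] ni[OF that]] inn[OF that]
    by simp
  define L where "L p q = cmul (- \<i> / 2) (p + q) + R (cmul (- 1 / 2) (p - q))" for p q
  have L_bl: "bounded_linear (cmul (- \<i> / 2))" "bounded_linear (\<lambda>y. R (cmul (- 1 / 2) y))"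
    using R by (simp_all only: linear_conv_bounded_linear bounded_linear_cmul
        bounded_linear_compose[OF _ bounded_linear_cmul])
  have even: "(p + q) / 2 * (- \<i> * d) = - \<i> / 2 * (d * p + d * q)" for p q d
    by (simp add: field_simps)
  have odd: "(p - q) / (2 * \<i>) * (- \<i> * d) = - 1 / 2 * (d * p - d * q)" for p q d
    by (simp add: field_simps)
  have si: "slice_integrand R h z \<gamma>
      = (\<lambda>t. L (cauchy_integrand h z \<gamma> t) (cauchy_integrand h (cnj z) \<gamma> t))" for \<gamma>
  proof
    fix t
    define d where "d = vector_derivative \<gamma> (at t within {0..1})"
    have "kernel_even z (\<gamma> t) * (- \<i> * d) = - \<i> / 2 * (d / (\<gamma> t - z) + d / (\<gamma> t - cnj z))"
      by (simp only: kernel_even_def even times_divide_eq_right mult_1_right)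
    moreover have "kernel_odd z (\<gamma> t) * (- \<i> * d) = - 1 / 2 * (d / (\<gamma> t - z) - d / (\<gamma> t - cnj z))"
      by (simp only: kernel_odd_def odd times_divide_eq_right mult_1_right)
    ultimately show "slice_integrand R h z \<gamma> t
        = L (cauchy_integrand h z \<gamma> t) (cauchy_integrand h (cnj z) \<gamma> t)"
      unfolding slice_integrand_def L_def cauchy_integrand_def Let_def d_def[symmetric]
      by (simp only: cmul_cmul[symmetric] cmul_add_left[symmetric] cmul_diff_left[symmetric])
  qed
  have int: "(slice_integrand R h z \<gamma> has_integral L (I z \<gamma>) (I (cnj z) \<gamma>)) {0..1}" if "\<gamma> \<in> \<Gamma>" for \<gamma>
    unfolding si L_def
    using has_integral_linear[OF has_integral_add[OF I[OF z(1) that] I[OF z(2) that]] L_bl(1)]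
      has_integral_linear[OF has_integral_diff[OF I[OF z(1) that] I[OF z(2) that]] L_bl(2)]
    by (intro has_integral_add) (simp_all add: o_def)
  then show "\<gamma> \<in> \<Gamma> \<Longrightarrow> slice_integrand R h z \<gamma> integrable_on {0..1}"
    by (rule has_integral_integrable)
  have "(\<Sum>\<gamma>\<in>\<Gamma>. integral {0..1} (slice_integrand R h z \<gamma>)) = (\<Sum>\<gamma>\<in>\<Gamma>. L (I z \<gamma>) (I (cnj z) \<gamma>))"
    by (intro sum.cong refl integral_unique int)
  also have "\<dots> = L (\<Sum>\<gamma>\<in>\<Gamma>. I z \<gamma>) (\<Sum>\<gamma>\<in>\<Gamma>. I (cnj z) \<gamma>)"
    unfolding L_def sum.distrib
    by (simp only: linear_sum[OF bounded_linear.linear[OF L_bl(1)], symmetric]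
        linear_sum[OF bounded_linear.linear[OF L_bl(2)], symmetric] sum.distrib sum_subtractf)
  also have "\<dots> = L (cmul (2 * pi * \<i>) (f z)) (cmul (2 * pi * \<i>) (f (cnj z)))"
    using M by (simp add: sum_I z h_def holomorphic_part_at)
  also have "\<dots> = cmul pi (f z + f (cnj z)) + R (cmul (- (pi * \<i>)) (f z - f (cnj z)))"
  proof -
    have "- \<i> / 2 * (2 * pi * \<i>) = pi" "- 1 / 2 * (2 * pi * \<i>) = - (pi * \<i>)"
      by (simp_all add: complex_eq_iff)
    then show ?thesis
      by (simp only: L_def cmul_add_right[symmetric] cmul_diff_right[symmetric] cmul_cmul)
  qed
  also have "\<dots> = pi *\<^sub>R (f z + f (cnj z)) - pi *\<^sub>R R (J (f z - f (cnj z)))"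
  proof -
    have "cmul pi (f z + f (cnj z)) = pi *\<^sub>R (f z + f (cnj z))"
      "cmul (- (pi * \<i>)) (f z - f (cnj z)) = (- pi) *\<^sub>R J (f z - f (cnj z))"
      by (simp_all add: cmul_def)
    then show ?thesis by (simp only: linear_cmul[OF R]) simp
  qed
  finally show "(\<Sum>\<gamma>\<in>\<Gamma>. integral {0..1} (slice_integrand R h z \<gamma>))
      = pi *\<^sub>R (f z + f (cnj z)) - pi *\<^sub>R R (J (f z - f (cnj z)))" .
qed

text \<open>
  For a slice function, \<open>f z + f (cnj z) = 2 F0 z\<close> and \<open>f z - f (cnj z) = 2 J (F1 z)\<close>, so that the value
  obtained before is the value of the slice function on the slice of \<open>R\<close>.
\<close>

corollary poly_slice_cauchy_formula_stem:
  fixes F0 F1 :: "complex \<Rightarrow> 'b"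
  assumes S: "open S" and C: "class_C M S F0" "class_C M S F1"
    and cr: "\<And>f z. cr f z = pd_u f z + J (pd_v f z)"
    and zero: "\<And>z. z \<in> S \<Longrightarrow> (1 / 2 ^ M) *\<^sub>R (cr ^^ M) (\<lambda>w. F0 w + J (F1 w)) z = 0"
    and M: "M \<ge> 1" and R: "linear R"
    and D: "open D" "bounded D" "closure D \<subseteq> S" and \<Gamma>: "positive_boundary \<Gamma> D"
    and z: "z \<in> D" "cnj z \<in> D" and stem: "F0 (cnj z) = F0 z" "F1 (cnj z) = - F1 z"
  defines "h \<equiv> holomorphic_part M (Re z) (\<lambda>w. F0 w + J (F1 w))"
  shows "\<gamma> \<in> \<Gamma> \<Longrightarrow> slice_integrand R h z \<gamma> integrable_on {0..1}"
    and "(\<Sum>\<gamma>\<in>\<Gamma>. integral {0..1} (slice_integrand R h z \<gamma>)) = (2 * pi) *\<^sub>R (F0 z + R (F1 z))"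
proof -
  define f where "f w = F0 w + J (F1 w)" for w
  have f: "class_C M S f"
    unfolding f_def by (intro class_C_add class_C_linear[OF S bounded_linear_J] S C)
  have zero': "(dbar ^^ M) f z = 0" if "z \<in> S" for z
    using zero[OF that] cr_funpow_eq_dbar_funpow[OF cr S f order_refl that]
    by (simp add: f_def[abs_def])
  have h: "h = holomorphic_part M (Re z) f"
    unfolding h_def f_def[abs_def] ..
  show "\<gamma> \<in> \<Gamma> \<Longrightarrow> slice_integrand R h z \<gamma> integrable_on {0..1}"
    unfolding h by (rule poly_slice_cauchy_formula(1)[OF S f zero' M R D \<Gamma> z])
  have "(\<Sum>\<gamma>\<in>\<Gamma>. integral {0..1} (slice_integrand R h z \<gamma>))
      = pi *\<^sub>R (f z + f (cnj z)) - pi *\<^sub>R R (J (f z - f (cnj z)))"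
    unfolding h by (rule poly_slice_cauchy_formula(2)[OF S f zero' M R D \<Gamma> z])
  also have "f z + f (cnj z) = 2 *\<^sub>R F0 z"
    by (simp add: f_def stem J_simps scaleR_2)
  also have "f z - f (cnj z) = 2 *\<^sub>R J (F1 z)"
    by (simp add: f_def stem J_simps scaleR_2)
  also have "pi *\<^sub>R 2 *\<^sub>R F0 z - pi *\<^sub>R R (J (2 *\<^sub>R J (F1 z))) = (2 * pi) *\<^sub>R (F0 z + R (F1 z))"
    by (simp add: J_simps J_J linear_cmul[OF R] linear_neg[OF R] scaleR_add_right mult.commute)
  finally show "(\<Sum>\<gamma>\<in>\<Gamma>. integral {0..1} (slice_integrand R h z \<gamma>)) = (2 * pi) *\<^sub>R (F0 z + R (F1 z))" .
qed

end

section \<open>Slices and Cauchy kernels in the Clifford algebra\<close>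

text \<open>
  Adding the double sum for the square to the same sum with the two generators exchanged leaves only the
  anticommutators.
\<close>

lemma imag_unit_square:
  fixes j :: "'n::{finite,linorder} vec_part"
  assumes "norm j = 1"
  shows "imag_unit j * imag_unit j = - 1"
proof -
  let ?e = "clifford_gen :: 'n \<Rightarrow> _"
  define P where "P = imag_unit j * imag_unit j"
  have P1: "P = (\<Sum>a\<in>UNIV. \<Sum>b\<in>UNIV. (j $ a * j $ b) *\<^sub>R (?e a * ?e b))"
  proof -
    have "imag_unit j = (\<Sum>a\<in>UNIV. j $ a *\<^sub>R ?e a)"
      by (simp add: imag_unit_def paravec_def)
    then have "P = (\<Sum>a\<in>UNIV. \<Sum>b\<in>UNIV. (j $ a *\<^sub>R ?e a) * (j $ b *\<^sub>R ?e b))"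
      unfolding P_def by (simp only: sum_product)
    then show ?thesis by (simp add: mult.commute)
  qed
  then have P2: "P = (\<Sum>a\<in>UNIV. \<Sum>b\<in>UNIV. (j $ a * j $ b) *\<^sub>R (?e b * ?e a))"
    by (subst sum.swap) (simp add: mult_ac)
  have "?e a * ?e b + ?e b * ?e a = (if a = b then - 2 else 0)" for a b
    by (simp add: clifford_gen_square clifford_gen_anticommute)
  then have "P + P = (\<Sum>a\<in>UNIV. \<Sum>b\<in>UNIV. (j $ a * j $ b) *\<^sub>R (if a = b then - 2 else 0))"
    by (subst (1) P1, subst P2) (simp flip: sum.distrib scaleR_add_right)
  also have "\<dots> = (\<Sum>a\<in>UNIV. \<Sum>b\<in>UNIV. if a = b then (j $ a)\<^sup>2 *\<^sub>R (- 2) else 0)"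
    by (intro sum.cong refl) (simp add: power2_eq_square)
  also have "\<dots> = (\<Sum>a\<in>UNIV. (j $ a)\<^sup>2) *\<^sub>R (- 2)"
    by (simp add: scaleR_sum_left sum_negf)
  also have "(\<Sum>a\<in>UNIV. (j $ a)\<^sup>2) = (norm j)\<^sup>2"
    by (simp add: norm_eq_sqrt_inner inner_vec_def power2_eq_square sum_nonneg)
  finally have "2 *\<^sub>R P = 2 *\<^sub>R (- 1 :: 'n clifford)"
    using assms by (simp add: scaleR_2)
  then show ?thesis unfolding P_def by (simp only: scaleR_cancel_left) simp
qed

lemma paravec_slice_point:
  "paravec (slice_point j z) = of_real (Re z) + Im z *\<^sub>R imag_unit j"
  by (simp add: paravec_def slice_point_def imag_unit_def scaleR_sum_right)

lemma paravec_slice_point_arith: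
  "paravec (slice_point j (a + b)) = paravec (slice_point j a) + paravec (slice_point j b)"
  "paravec (slice_point j (a - b)) = paravec (slice_point j a) - paravec (slice_point j b)"
  "paravec (slice_point j (- a)) = - paravec (slice_point j a)"
  "paravec (slice_point j 1) = 1"
  "paravec (slice_point j (of_real r)) = of_real r"
  "paravec (slice_point j \<i>) = imag_unit j"
  by (simp_all add: paravec_slice_point algebra_simps)

lemma paravec_slice_point_mult:
  assumes "norm j = 1"
  shows "paravec (slice_point j (a * b)) = paravec (slice_point j a) * paravec (slice_point j b)"
  using imag_unit_square[OF assms]
  by (simp add: paravec_slice_point algebra_simps of_real_def)

lemma clifford_inverse_eqI:
  assumes "a * b = 1" "b * a = 1"
  shows "clifford_inverse a = b"
  unfolding clifford_inverse_def
proof (rule the_equality)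
  fix c assume "a * c = 1 \<and> c * a = 1"
  then have "c = (b * a) * c" "b = b * (a * c)" using assms by simp_all
  then show "c = b" by (simp add: mult.assoc)
qed (use assms in simp)

text \<open>
  The quadratic has real coefficients, so it can be evaluated in the commutative slice of \<open>x\<close>, where it splits
  into linear factors and can be inverted.
\<close>

lemma kernel_quad_slice_point:
  assumes "norm j = 1" "norm k = 1"
  shows "kernel_quad (slice_point j s) (slice_point k z)
    = paravec (slice_point k ((z - s) * (z - cnj s)))"
proof -
  have "norm (slice_point j s) ^ 2 = (cmod s)\<^sup>2"
    using assms(1) by (simp add: slice_point_def norm_Pair cmod_def power_mult_distrib)
  moreover have "fst (slice_point j s) = Re s"
    by (simp add: slice_point_def)
  moreover have "(z - s) * (z - cnj s) = z * z - of_real (2 * Re s) * z + of_real ((cmod s)\<^sup>2)"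
    by (simp add: complex_eq_iff cmod_power2) (simp add: power2_eq_square algebra_simps)
  ultimately show ?thesis
    by (simp add: kernel_quad_def paravec_slice_point_arith paravec_slice_point_mult[OF assms(2)]
        power2_eq_square del: of_real_power of_real_mult)
      (simp add: of_real_def)
qed

lemma clifford_inverse_kernel_quad:
  assumes "norm j = 1" "norm k = 1" "s \<noteq> z" "s \<noteq> cnj z"
  shows "clifford_inverse (kernel_quad (slice_point j s) (slice_point k z))
    = paravec (slice_point k (1 / ((z - s) * (z - cnj s))))"
proof -
  have "(z - s) * (z - cnj s) \<noteq> 0" using assms(3,4) by auto
  then show ?thesis
    unfolding kernel_quad_slice_point[OF assms(1,2)]
    by (intro clifford_inverse_eqI)
      (simp_all add: paravec_slice_point_mult[OF assms(2), symmetric] paravec_slice_point_arith)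
qed

text \<open>
  Real and imaginary parts are taken as half sums and half differences of conjugates; the factors
  \<open>z - cnj s\<close> and \<open>cnj z - cnj s\<close> that appear then cancel against those of \<open>r\<close> and \<open>cnj r\<close>.
\<close>

lemma kernel_even_odd_eq:
  assumes "s \<noteq> z" "s \<noteq> cnj z"
  defines "r \<equiv> 1 / ((z - s) * (z - cnj s))"
  shows "kernel_even z s = of_real (Re (- r * z)) + of_real (Re r) * cnj s"
    and "kernel_odd z s = of_real (Im (- r * z)) + of_real (Im r) * cnj s"
proof -
  have nz: "z - cnj s \<noteq> 0" "cnj z - cnj s \<noteq> 0"
    using assms(1,2) by auto
  have r: "r * (z - cnj s) = - (1 / (s - z))"
    using assms(1) nz(1) unfolding r_def by (simp add: divide_simps)
  have r': "cnj r * (cnj z - cnj s) = - (1 / (s - cnj z))"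
    using assms(2) nz(2) unfolding r_def by (simp add: divide_simps)
  have re: "of_real (Re a) = (a + cnj a) / 2" and im: "of_real (Im a) = (a - cnj a) / (2 * \<i>)" for a
    by (simp_all add: complex_eq_iff)
  have "of_real (Re (- r * z)) + of_real (Re r) * cnj s
      = - (r * (z - cnj s) + cnj r * (cnj z - cnj s)) / 2"
    unfolding re by (simp add: field_simps)
  then show "kernel_even z s = of_real (Re (- r * z)) + of_real (Re r) * cnj s"
    by (simp add: r r' kernel_even_def)
  have "of_real (Im (- r * z)) + of_real (Im r) * cnj s
      = - (r * (z - cnj s) - cnj r * (cnj z - cnj s)) / (2 * \<i>)"
    unfolding im by (simp add: field_simps)
  then show "kernel_odd z s = of_real (Im (- r * z)) + of_real (Im r) * cnj s"
    by (simp add: r r' kernel_odd_def)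
qed

lemma paravec_slice_point_real_affine:
  "paravec (slice_point j (of_real a + of_real b * c))
    = of_real a + b *\<^sub>R paravec (slice_point j c)"
  by (simp add: paravec_slice_point algebra_simps of_real_def)

lemma paravec_pcnj_slice_point: "paravec (pcnj (slice_point j s)) = paravec (slice_point j (cnj s))"
  by (simp add: pcnj_def slice_point_def)

text \<open>
  The inverse of the quadratic lies in the slice of \<open>k\<close>, the factor \<open>cnj s\<close> in that of \<open>j\<close>. Splitting the former
  into its real and imaginary part leaves \<open>k\<close> on one side and elements of the slice of \<open>j\<close> otherwise.
\<close>

lemma S_inv_slice_point:
  assumes "norm j = 1" "norm k = 1" "s \<noteq> z" "s \<noteq> cnj z"
  shows "S_L_inv (slice_point j s) (slice_point k z)
      = paravec (slice_point j (kernel_even z s)) + imag_unit k * paravec (slice_point j (kernel_odd z s))"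
    and "S_R_inv (slice_point j s) (slice_point k z)
      = paravec (slice_point j (kernel_even z s)) + paravec (slice_point j (kernel_odd z s)) * imag_unit k"
proof -
  define r where "r = 1 / ((z - s) * (z - cnj s))"
  have rz: "paravec (slice_point k r) * paravec (slice_point k z) = paravec (slice_point k (r * z))"
    "paravec (slice_point k z) * paravec (slice_point k r) = paravec (slice_point k (r * z))"
    by (simp_all add: paravec_slice_point_mult[OF assms(2), symmetric] mult.commute)
  have k: "paravec (slice_point k a) = of_real (Re a) + Im a *\<^sub>R imag_unit k" for a
    by (rule paravec_slice_point)
  note kern = kernel_even_odd_eq[OF assms(3,4), folded r_def] clifford_inverse_kernel_quad[OF assms, folded r_def]
  define Y where "Y = paravec (slice_point j (cnj s))"
  have "S_L_inv (slice_point j s) (slice_point k z)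
      = - paravec (slice_point k (r * z)) + paravec (slice_point k r) * Y"
    unfolding S_L_inv_def kern paravec_pcnj_slice_point Y_def[symmetric]
    by (simp add: algebra_simps rz)
  also have "\<dots> = (of_real (Re (- r * z)) + Re r *\<^sub>R Y) + imag_unit k * (of_real (Im (- r * z)) + Im r *\<^sub>R Y)"
    unfolding k by (simp add: algebra_simps of_real_def)
  also have "\<dots> = paravec (slice_point j (kernel_even z s)) + imag_unit k * paravec (slice_point j (kernel_odd z s))"
    unfolding kern paravec_slice_point_real_affine Y_def ..
  finally show "S_L_inv (slice_point j s) (slice_point k z)
      = paravec (slice_point j (kernel_even z s)) + imag_unit k * paravec (slice_point j (kernel_odd z s))" .
  have "S_R_inv (slice_point j s) (slice_point k z)
      = - paravec (slice_point k (r * z)) + Y * paravec (slice_point k r)"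
    unfolding S_R_inv_def kern paravec_pcnj_slice_point Y_def[symmetric]
    by (simp add: algebra_simps rz)
  also have "\<dots> = (of_real (Re (- r * z)) + Re r *\<^sub>R Y) + (of_real (Im (- r * z)) + Im r *\<^sub>R Y) * imag_unit k"
    unfolding k by (simp add: algebra_simps of_real_def)
  also have "\<dots> = paravec (slice_point j (kernel_even z s)) + paravec (slice_point j (kernel_odd z s)) * imag_unit k"
    unfolding kern paravec_slice_point_real_affine Y_def ..
  finally show "S_R_inv (slice_point j s) (slice_point k z)
      = paravec (slice_point j (kernel_even z s)) + paravec (slice_point j (kernel_odd z s)) * imag_unit k" .
qed

section \<open>Axially symmetric sets and their slices\<close>

lemma slice_point_in_sphere_of:
  assumes "norm j = 1" "norm k = 1"
  shows "slice_point k z \<in> sphere_of (slice_point j z)"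
proof (cases "Im z \<ge> 0")
  case True
  then show ?thesis using assms
    unfolding sphere_of_def slice_point_def by (auto intro!: exI[of _ k])
next
  case False
  then show ?thesis using assms
    unfolding sphere_of_def slice_point_def by (auto intro!: exI[of _ "- k"])
qed

text \<open>
  By axial symmetry a single slice determines the set: points of the slices of \<open>j\<close> and of \<open>k\<close> with the same
  coordinates lie on a common sphere.
\<close>

lemma plane_domain_eq_slice:
  assumes "axially_symmetric W" "norm j = 1"
  shows "plane_domain W = slice j W"
  using assms slice_point_in_sphere_of[of j]
  unfolding plane_domain_def slice_def axially_symmetric_def by fastforce

lemma cnj_in_plane_domain:
  assumes "z \<in> plane_domain W"
  shows "cnj z \<in> plane_domain W"
  unfolding plane_domain_def
proof (intro CollectI ballI)
  fix j :: "'a vec_part" assume "j \<in> imag_units"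
  then have "slice_point (- j) z \<in> W"
    using assms unfolding plane_domain_def by auto
  then show "slice_point j (cnj z) \<in> W"
    by (simp add: slice_point_def)
qed

lemma continuous_on_slice_point: "continuous_on A (slice_point j)"
  unfolding slice_point_def[abs_def] by (intro continuous_intros)

lemma open_slice: "open W \<Longrightarrow> open (slice j W)"
  using open_vimage[OF _ continuous_on_slice_point] by (simp add: slice_def vimage_def)

lemma closed_slice: "closed W \<Longrightarrow> closed (slice j W)"
  using closed_vimage[OF _ continuous_on_slice_point] by (simp add: slice_def vimage_def)

lemma closure_slice_subset:
  assumes "closure U \<subseteq> W"
  shows "closure (slice j U) \<subseteq> slice j W"
proof -
  have "closure (slice j U) \<subseteq> slice j (closure U)"
    by (rule closure_minimal) (use closure_subset in \<open>auto simp: slice_def intro: closed_slice[unfolded slice_def]\<close>)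
  also have "\<dots> \<subseteq> slice j W" using assms by (auto simp: slice_def)
  finally show ?thesis .
qed

lemma bounded_slice:
  assumes "bounded U" "norm j = 1"
  shows "bounded (slice j U)"
proof -
  obtain B where B: "\<And>x. x \<in> U \<Longrightarrow> norm x \<le> B" using assms(1) by (auto simp: bounded_iff)
  have "cmod z = norm (slice_point j z)" for z
    using assms(2) by (simp add: slice_point_def norm_Pair cmod_def)
  then have "cmod z \<le> B" if "z \<in> slice j U" for z
    using B[of "slice_point j z"] that by (simp add: slice_def)
  then show ?thesis by (auto simp: bounded_iff)
qed

lemma point_on_slice:
  fixes x :: "'n::finite point"
  obtains k z where "norm k = 1" "x = slice_point k z"
proof (cases "snd x = 0")
  case True
  obtain k :: "'n vec_part" where "norm k = 1" using vector_choose_size[of 1] by auto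
  with True that[of k "of_real (fst x)"] show ?thesis
    by (auto simp: slice_point_def prod_eq_iff)
next
  case False
  with that[of "snd x /\<^sub>R norm (snd x)" "Complex (fst x) (norm (snd x))"] show ?thesis
    by (auto simp: slice_point_def prod_eq_iff)
qed

section \<open>The left and the right Cauchy formula\<close>

lemma complex_structure_left:
  assumes "norm j = 1"
  shows "complex_structure ((*) (imag_unit j))"
proof (rule complex_structure.intro)
  show "linear ((*) (imag_unit j))"
    by (rule linearI) (simp_all add: algebra_simps)
  show "imag_unit j * (imag_unit j * y) = - y" for y
    by (simp add: mult.assoc[symmetric] imag_unit_square[OF assms])
qed

lemma complex_structure_right:
  assumes "norm j = 1"
  shows "complex_structure (\<lambda>y. y * imag_unit j)"
proof (rule complex_structure.intro)
  show "linear (\<lambda>y. y * imag_unit j)"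
    by (rule linearI) (simp_all add: algebra_simps)
  show "y * imag_unit j * imag_unit j = - y" for y
    by (simp add: mult.assoc imag_unit_square[OF assms])
qed

lemma ds_eq:
  assumes "norm j = 1"
  shows "ds j \<gamma> t = paravec (slice_point j (- \<i> * vector_derivative \<gamma> (at t within {0..1})))"
proof -
  have "ds j \<gamma> t = paravec (slice_point j (vector_derivative \<gamma> (at t within {0..1}) * (- \<i>)))"
    unfolding ds_def paravec_slice_point_mult[OF assms] paravec_slice_point_arith ..
  then show ?thesis by (simp add: mult.commute)
qed

lemma slice_point_and_conjugate:
  fixes U :: "'n::finite point set"
  assumes "axially_symmetric U" "x \<in> U" "norm j = 1"
  obtains k z where "norm k = 1" "x = slice_point k z" "z \<in> slice j U" "cnj z \<in> slice j U"
proof -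
  obtain k z where k: "norm k = 1" and xz: "x = slice_point k z" by (rule point_on_slice)
  have "z \<in> slice k U" using assms(2) xz by (simp add: slice_def)
  then have "z \<in> plane_domain U" by (simp add: plane_domain_eq_slice[OF assms(1) k])
  then have "z \<in> slice j U" "cnj z \<in> slice j U"
    using cnj_in_plane_domain by (auto simp flip: plane_domain_eq_slice[OF assms(1,3)])
  then show ?thesis using that k xz by blast
qed

lemma slice_in_plane_domain:
  assumes "bounded U" "slice_Cauchy_domain U" "open W" "axially_symmetric W" "closure U \<subseteq> W" "norm j = 1"
  shows "open (plane_domain W)" "open (slice j U)" "bounded (slice j U)"
    "closure (slice j U) \<subseteq> plane_domain W"
  unfolding plane_domain_eq_slice[OF assms(4,6)]
  using assms by (auto simp: slice_Cauchy_domain_def open_slice bounded_slice dest: closure_slice_subset)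

lemma positive_boundary_avoids:
  assumes "positive_boundary \<Gamma> D" "open D" "\<gamma> \<in> \<Gamma>" "t \<in> {0..1}"
  shows "\<gamma> t \<in> closure D" "\<gamma> t \<notin> D"
proof -
  have "\<gamma> t \<in> frontier D"
    using assms unfolding positive_boundary_def path_image_def by blast
  then show "\<gamma> t \<in> closure D" "\<gamma> t \<notin> D"
    using assms(2) by (auto simp: frontier_def interior_open)
qed

text \<open>
  The case of \<open>J\<close> and \<open>R\<close> being left multiplications. The real factor of \<open>P_S_L_inv\<close> moves to the derivatives of
  \<open>F\<close>, where it builds the holomorphic part; the remaining kernel \<open>S_L_inv\<close> splits into its even and odd
  components. The derivatives of \<open>F\<close> on the slice are those of the stem functions, since \<open>F\<close> and \<open>F0 + j F1\<close>
  agree on an open set.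
\<close>

theorem left_cauchy_formula:
  fixes U :: "'n::{finite,linorder} point set"
  assumes M: "M \<ge> 1" and U: "bounded U" "slice_Cauchy_domain U"
    and F: "left_poly_slice_monogenic_near M (closure U) F"
    and j: "j \<in> imag_units" and \<Gamma>: "positive_boundary \<Gamma> (slice j U)" and x: "x \<in> U"
  shows "\<gamma> \<in> \<Gamma> \<Longrightarrow> left_integrand M F x j \<gamma> integrable_on {0..1}"
    and "left_integral M F x j \<Gamma> = (2 * pi) *\<^sub>R F x"
proof -
  have j: "norm j = 1" using j by simp
  interpret complex_structure "(*) (imag_unit j)" by (rule complex_structure_left[OF j])
  obtain W where W: "open W" "axially_symmetric W" "closure U \<subseteq> W" "left_poly_slice_monogenic M W F"
    using F unfolding left_poly_slice_monogenic_near_def by blast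
  define S where "S = plane_domain W"
  obtain F0 F1 where eo: "even_odd_pair S F0 F1"
    and F_eq: "\<And>z k. z \<in> S \<Longrightarrow> norm k = 1 \<Longrightarrow> F (slice_point k z) = F0 z + imag_unit k * F1 z"
    and C: "class_C M S F0" "class_C M S F1"
    and zero: "\<And>z. z \<in> S \<Longrightarrow> (1 / 2 ^ M) *\<^sub>R (cr_left j ^^ M) (\<lambda>w. F0 w + imag_unit j * F1 w) z = 0"
    using W(4) j unfolding left_poly_slice_monogenic_def S_def by auto
  define f where "f w = F0 w + imag_unit j * F1 w" for w
  have f: "f = (\<lambda>w. F0 w + imag_unit j * F1 w)" by (simp add: f_def fun_eq_iff)
  have axU: "axially_symmetric U" using U(2) by (simp add: slice_Cauchy_domain_def)
  obtain k z where k: "norm k = 1" and xz: "x = slice_point k z"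
    and z: "z \<in> slice j U" "cnj z \<in> slice j U"
    by (rule slice_point_and_conjugate[OF axU x j])
  note SD = slice_in_plane_domain[OF U W(1-3) j, folded S_def]
  have zS: "z \<in> S" using z(1) SD(4) closure_subset by blast
  have stem: "F0 (cnj z) = F0 z" "F1 (cnj z) = - F1 z"
    using eo zS by (simp_all add: even_odd_pair_def)
  define h where "h = holomorphic_part M (Re z) f"
  have R: "linear ((*) (imag_unit k))" by (rule linearI) (simp_all add: algebra_simps)
  note formula = poly_slice_cauchy_formula_stem[OF SD(1) C cr_left_def zero M R SD(2-4) \<Gamma> z stem,
      folded f, folded h_def]
  have cmul: "cmul a y = paravec (slice_point j a) * y" for a y
    by (simp add: cmul_def paravec_slice_point algebra_simps of_real_def)
  have integrand: "left_integrand M F x j \<gamma> t = slice_integrand ((*) (imag_unit k)) h z \<gamma> t"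
    if g: "\<gamma> \<in> \<Gamma>" and t: "t \<in> {0..1}" for \<gamma> t
  proof -
    note avoid = positive_boundary_avoids[OF \<Gamma> SD(2) g t]
    have s: "\<gamma> t \<in> S" "\<gamma> t \<noteq> z" "\<gamma> t \<noteq> cnj z"
      using avoid SD(4) z by auto
    have dbar_eq: "dbar_left j = dbar"
      by (simp add: fun_eq_iff dbar_left_def cr_left_def dbar_def)
    have g_eq: "(dbar_left j ^^ l) (\<lambda>w. F (slice_point j w)) (\<gamma> t) = (dbar ^^ l) f (\<gamma> t)" for l
      unfolding dbar_eq by (rule dbar_funpow_cong[OF SD(1) _ s(1)]) (simp add: F_eq j f_def)
    define K where "K = S_L_inv (slice_point j (\<gamma> t)) x"
    have coeff: "fst (slice_point j (\<gamma> t) - x) = Re (\<gamma> t) - Re z"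
      by (simp add: xz slice_point_def)
    have "left_integrand M F x j \<gamma> t = (\<Sum>l<M. K * ds j \<gamma> t * (((- 2 * (Re (\<gamma> t) - Re z)) ^ l / fact l) *\<^sub>R (dbar ^^ l) f (\<gamma> t)))"
      unfolding left_integrand_def P_S_L_inv_def coeff g_eq K_def[symmetric]
      by (simp only: mult_scaleR_left mult_scaleR_right scaleR_scaleR power_mult_distrib times_divide_eq_right)
    also have "\<dots> = K * ds j \<gamma> t * (h (\<gamma> t))"
      unfolding h_def holomorphic_part_def by (simp add: sum_distrib_left)
    finally show ?thesis
      unfolding slice_integrand_def Let_def cmul K_def xz S_inv_slice_point[OF j k s(2,3)]
        ds_eq[OF j] paravec_slice_point_mult[OF j]
      by (simp add: algebra_simps)
  qed
  have "slice_integrand ((*) (imag_unit k)) h z \<gamma> integrable_on {0..1}" if "\<gamma> \<in> \<Gamma>" for \<gamma>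
    by (rule formula(1)[OF _ that])
  then show "\<gamma> \<in> \<Gamma> \<Longrightarrow> left_integrand M F x j \<gamma> integrable_on {0..1}"
    using integrable_cong[of "{0..1}" "left_integrand M F x j \<gamma>"] integrand by blast
  have "left_integral M F x j \<Gamma>
      = (\<Sum>\<gamma>\<in>\<Gamma>. integral {0..1} (slice_integrand ((*) (imag_unit k)) h z \<gamma>))"
    unfolding left_integral_def by (intro sum.cong refl integral_cong integrand)
  also have "\<dots> = (2 * pi) *\<^sub>R (F0 z + imag_unit k * F1 z)"
    by (rule formula(2))
  also have "F0 z + imag_unit k * F1 z = F x"
    using F_eq[OF zS k] xz by simp
  finally show "left_integral M F x j \<Gamma> = (2 * pi) *\<^sub>R F x" .
qed

text \<open>
  The mirror image of the left formula, with right multiplications for \<open>J\<close> and \<open>R\<close>. Here \<open>ds\<close> stands to the left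
  of the kernel, and it commutes with the kernel components because all of them lie in the slice of \<open>j\<close>.
\<close>

theorem right_cauchy_formula:
  fixes U :: "'n::{finite,linorder} point set"
  assumes M: "M \<ge> 1" and U: "bounded U" "slice_Cauchy_domain U"
    and F: "right_poly_slice_monogenic_near M (closure U) F"
    and j: "j \<in> imag_units" and \<Gamma>: "positive_boundary \<Gamma> (slice j U)" and x: "x \<in> U"
  shows "\<gamma> \<in> \<Gamma> \<Longrightarrow> right_integrand M F x j \<gamma> integrable_on {0..1}"
    and "right_integral M F x j \<Gamma> = (2 * pi) *\<^sub>R F x"
proof -
  have j: "norm j = 1" using j by simp
  interpret complex_structure "\<lambda>y. y * imag_unit j" by (rule complex_structure_right[OF j])
  obtain W where W: "open W" "axially_symmetric W" "closure U \<subseteq> W" "right_poly_slice_monogenic M W F"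
    using F unfolding right_poly_slice_monogenic_near_def by blast
  define S where "S = plane_domain W"
  obtain F0 F1 where eo: "even_odd_pair S F0 F1"
    and F_eq: "\<And>z k. z \<in> S \<Longrightarrow> norm k = 1 \<Longrightarrow> F (slice_point k z) = F0 z + F1 z * imag_unit k"
    and C: "class_C M S F0" "class_C M S F1"
    and zero: "\<And>z. z \<in> S \<Longrightarrow> (1 / 2 ^ M) *\<^sub>R (cr_right j ^^ M) (\<lambda>w. F0 w + F1 w * imag_unit j) z = 0"
    using W(4) j unfolding right_poly_slice_monogenic_def S_def by auto
  define f where "f w = F0 w + F1 w * imag_unit j" for w
  have f: "f = (\<lambda>w. F0 w + F1 w * imag_unit j)" by (simp add: f_def fun_eq_iff)
  have axU: "axially_symmetric U" using U(2) by (simp add: slice_Cauchy_domain_def)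
  obtain k z where k: "norm k = 1" and xz: "x = slice_point k z"
    and z: "z \<in> slice j U" "cnj z \<in> slice j U"
    by (rule slice_point_and_conjugate[OF axU x j])
  note SD = slice_in_plane_domain[OF U W(1-3) j, folded S_def]
  have zS: "z \<in> S" using z(1) SD(4) closure_subset by blast
  have stem: "F0 (cnj z) = F0 z" "F1 (cnj z) = - F1 z"
    using eo zS by (simp_all add: even_odd_pair_def)
  define h where "h = holomorphic_part M (Re z) f"
  have R: "linear (\<lambda>y. y * imag_unit k)" by (rule linearI) (simp_all add: algebra_simps)
  note formula = poly_slice_cauchy_formula_stem[OF SD(1) C cr_right_def zero M R SD(2-4) \<Gamma> z stem,
      folded f, folded h_def]
  have cmul: "cmul a y = y * paravec (slice_point j a)" for a y
    by (simp add: cmul_def paravec_slice_point algebra_simps of_real_def)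
  have integrand: "right_integrand M F x j \<gamma> t = slice_integrand (\<lambda>y. y * imag_unit k) h z \<gamma> t"
    if g: "\<gamma> \<in> \<Gamma>" and t: "t \<in> {0..1}" for \<gamma> t
  proof -
    note avoid = positive_boundary_avoids[OF \<Gamma> SD(2) g t]
    have s: "\<gamma> t \<in> S" "\<gamma> t \<noteq> z" "\<gamma> t \<noteq> cnj z"
      using avoid SD(4) z by auto
    have dbar_eq: "dbar_right j = dbar"
      by (simp add: fun_eq_iff dbar_right_def cr_right_def dbar_def)
    have g_eq: "(dbar_right j ^^ l) (\<lambda>w. F (slice_point j w)) (\<gamma> t) = (dbar ^^ l) f (\<gamma> t)" for l
      unfolding dbar_eq by (rule dbar_funpow_cong[OF SD(1) _ s(1)]) (simp add: F_eq j f_def)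
    define K where "K = S_R_inv (slice_point j (\<gamma> t)) x"
    have coeff: "fst (slice_point j (\<gamma> t) - x) = Re (\<gamma> t) - Re z"
      by (simp add: xz slice_point_def)
    have "right_integrand M F x j \<gamma> t = (\<Sum>l<M. (((- 2 * (Re (\<gamma> t) - Re z)) ^ l / fact l) *\<^sub>R (dbar ^^ l) f (\<gamma> t)) * ds j \<gamma> t * K)"
      unfolding right_integrand_def P_S_R_inv_def coeff g_eq K_def[symmetric]
      by (simp only: mult_scaleR_left mult_scaleR_right scaleR_scaleR power_mult_distrib times_divide_eq_right)
    also have "\<dots> = (h (\<gamma> t)) * ds j \<gamma> t * K"
      unfolding h_def holomorphic_part_def by (simp add: sum_distrib_right)
    finally show ?thesis
      unfolding slice_integrand_def Let_def cmul K_def xz S_inv_slice_point[OF j k s(2,3)]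
        ds_eq[OF j] mult.commute[of _ "- \<i> * _"] paravec_slice_point_mult[OF j, of "- \<i> * _"]
      by (simp add: algebra_simps)
  qed
  have "slice_integrand (\<lambda>y. y * imag_unit k) h z \<gamma> integrable_on {0..1}" if "\<gamma> \<in> \<Gamma>" for \<gamma>
    by (rule formula(1)[OF _ that])
  then show "\<gamma> \<in> \<Gamma> \<Longrightarrow> right_integrand M F x j \<gamma> integrable_on {0..1}"
    using integrable_cong[of "{0..1}" "right_integrand M F x j \<gamma>"] integrand by blast
  have "right_integral M F x j \<Gamma>
      = (\<Sum>\<gamma>\<in>\<Gamma>. integral {0..1} (slice_integrand (\<lambda>y. y * imag_unit k) h z \<gamma>))"
    unfolding right_integral_def by (intro sum.cong refl integral_cong integrand)
  also have "\<dots> = (2 * pi) *\<^sub>R (F0 z + F1 z * imag_unit k)"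
    by (rule formula(2))
  also have "F0 z + F1 z * imag_unit k = F x"
    using F_eq[OF zS k] xz by simp
  finally show "right_integral M F x j \<Gamma> = (2 * pi) *\<^sub>R F x" .
qed

theorem theorem4p5:
  fixes M :: nat and U :: "'n::{finite,linorder} point set"
  assumes "M \<ge> 1" and "bounded U" and "slice_Cauchy_domain U"
  shows
    "(\<forall>F. left_poly_slice_monogenic_near M (closure U) F \<longrightarrow>
        (\<forall>j\<in>imag_units. \<forall>\<Gamma>. positive_boundary \<Gamma> (slice j U) \<longrightarrow> (\<forall>x\<in>U.
           (\<forall>\<gamma>\<in>\<Gamma>. left_integrand M F x j \<gamma> integrable_on {0..1}) \<and>
           F x = (1 / (2 * pi)) *\<^sub>R left_integral M F x j \<Gamma>)))
   \<and> (\<forall>F. right_poly_slice_monogenic_near M (closure U) F \<longrightarrow>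
        (\<forall>j\<in>imag_units. \<forall>\<Gamma>. positive_boundary \<Gamma> (slice j U) \<longrightarrow> (\<forall>x\<in>U.
           (\<forall>\<gamma>\<in>\<Gamma>. right_integrand M F x j \<gamma> integrable_on {0..1}) \<and>
           F x = (1 / (2 * pi)) *\<^sub>R right_integral M F x j \<Gamma>)))
   \<and> (\<forall>F U'. bounded U' \<and> slice_Cauchy_domain U' \<and>
        left_poly_slice_monogenic_near M (closure U) F \<and>
        left_poly_slice_monogenic_near M (closure U') F \<longrightarrow>
        (\<forall>j\<in>imag_units. \<forall>j'\<in>imag_units. \<forall>\<Gamma> \<Gamma>'.
           positive_boundary \<Gamma> (slice j U) \<and> positive_boundary \<Gamma>' (slice j' U') \<longrightarrow>
           (\<forall>x\<in>U \<inter> U'. left_integral M F x j \<Gamma> = left_integral M F x j' \<Gamma>')))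
   \<and> (\<forall>F U'. bounded U' \<and> slice_Cauchy_domain U' \<and>
        right_poly_slice_monogenic_near M (closure U) F \<and>
        right_poly_slice_monogenic_near M (closure U') F \<longrightarrow>
        (\<forall>j\<in>imag_units. \<forall>j'\<in>imag_units. \<forall>\<Gamma> \<Gamma>'.
           positive_boundary \<Gamma> (slice j U) \<and> positive_boundary \<Gamma>' (slice j' U') \<longrightarrow>
           (\<forall>x\<in>U \<inter> U'. right_integral M F x j \<Gamma> = right_integral M F x j' \<Gamma>')))"
proof -
  have left: "(\<forall>\<gamma>\<in>\<Gamma>. left_integrand M F x j \<gamma> integrable_on {0..1}) \<and>
      left_integral M F x j \<Gamma> = (2 * pi) *\<^sub>R F x"
    if "bounded V" "slice_Cauchy_domain V" "left_poly_slice_monogenic_near M (closure V) F"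
      "j \<in> imag_units" "positive_boundary \<Gamma> (slice j V)" "x \<in> V"
    for V :: "'n point set" and F j \<Gamma> x
    using left_cauchy_formula[OF assms(1) that] by blast
  have right: "(\<forall>\<gamma>\<in>\<Gamma>. right_integrand M F x j \<gamma> integrable_on {0..1}) \<and>
      right_integral M F x j \<Gamma> = (2 * pi) *\<^sub>R F x"
    if "bounded V" "slice_Cauchy_domain V" "right_poly_slice_monogenic_near M (closure V) F"
      "j \<in> imag_units" "positive_boundary \<Gamma> (slice j V)" "x \<in> V"
    for V :: "'n point set" and F j \<Gamma> x
    using right_cauchy_formula[OF assms(1) that] by blast
  show ?thesis
    apply (intro conjI allI impI ballI)
    subgoal using left[OF assms(2,3)] by blast
    subgoal using left[OF assms(2,3)] by simp
    subgoal using right[OF assms(2,3)] by blast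
    subgoal using right[OF assms(2,3)] by simp
    subgoal for F V j j' \<Gamma> \<Gamma>' x using left[OF assms(2,3), of F j \<Gamma> x] left[of V F j' \<Gamma>' x] by simp
    subgoal for F V j j' \<Gamma> \<Gamma>' x using right[OF assms(2,3), of F j \<Gamma> x] right[of V F j' \<Gamma>' x] by simp
    done
qed

end
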